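(* Given a collection $\mathcal C$ of finitely generated groups, the following are equivalent: (1) There exists a proper coarse geodesic metric space $X$ on which each group in $\mathcal C$ acts properly discontinuously and cocompactly. (2) There exists a locally compact group $\mathcal G$ in which each group of $\mathcal C$ has a discrete, cocompact, finite kernel representation.
   Context: All locally compact groups are Hausdorff. A metric space is proper if its closed balls are compact. For $C\ge 0$, a $C$-coarse path from $x$ to $y$ is a finite sequence $x=x_0,\dots,x_n=y$ with $d(x_{i-1},x_i)\le C$ for all $i$; its path length is $\sum_i d(x_{i-1},x_i)$; it is a $C$-coarse geodesic if its path length equals $d(x,y)$. $X$ is a coarse geodesic metric space if there is $C\ge0$ such that any two points are joined by a $C$-coarse geodesic. Actions on metric spaces are by isometries. An action $g\mapsto\phi_g$ of $G$ on $X$ is properly discontinuous if for all compact $K,L\subset X$ the set $\{g\in G: \phi_g(K)\cap L\ne\emptyset\}$ is finite; it is cocompact if there is a compact set whose translates cover $X$. A discrete, cocompact, finite kernel representation $G\to\mathcal G$ is a homomorphism with finite kernel whose image is a discrete, cocompact subgroup of $\mathcal G$. *)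

theory Defs
  imports "HOL-Analysis.Analysis" "HOL-Algebra.Group_Action" "HOL-Algebra.Generated_Groups"
    "HOL-Algebra.Left_Coset"
begin

definition finitely_generated_group :: "'a monoid \<Rightarrow> bool" where
  "finitely_generated_group G \<longleftrightarrow>
     group G \<and> (\<exists>S. finite S \<and> S \<subseteq> carrier G \<and> generate G S = carrier G)"

context Metric_space
begin

definition proper_metric_space :: bool where
  "proper_metric_space \<longleftrightarrow> (\<forall>x\<in>M. \<forall>r. compactin mtopology (mcball x r))"

text \<open>A path is a sequence of \<open>n + 1\<close> points \<open>p 0, \<dots>, p n\<close>; later values of \<open>p\<close> are irrelevant.\<close>

definition coarse_path :: "real \<Rightarrow> 'a \<Rightarrow> 'a \<Rightarrow> nat \<Rightarrow> (nat \<Rightarrow> 'a) \<Rightarrow> bool" where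
  "coarse_path C x y n p \<longleftrightarrow>
     p 0 = x \<and> p n = y \<and> (\<forall>i\<le>n. p i \<in> M) \<and> (\<forall>i<n. d (p i) (p (Suc i)) \<le> C)"

definition path_len :: "nat \<Rightarrow> (nat \<Rightarrow> 'a) \<Rightarrow> real" where
  "path_len n p = (\<Sum>i<n. d (p i) (p (Suc i)))"

definition coarse_geodesic :: "real \<Rightarrow> 'a \<Rightarrow> 'a \<Rightarrow> nat \<Rightarrow> (nat \<Rightarrow> 'a) \<Rightarrow> bool" where
  "coarse_geodesic C x y n p \<longleftrightarrow> coarse_path C x y n p \<and> path_len n p = d x y"

definition coarse_geodesic_space :: bool where
  "coarse_geodesic_space \<longleftrightarrow>
     (\<exists>C\<ge>0. \<forall>x\<in>M. \<forall>y\<in>M. \<exists>n p. coarse_geodesic C x y n p)"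

definition isometric_action :: "'g monoid \<Rightarrow> ('g \<Rightarrow> 'a \<Rightarrow> 'a) \<Rightarrow> bool" where
  "isometric_action G \<phi> \<longleftrightarrow>
     group_action G M \<phi> \<and>
     (\<forall>g\<in>carrier G. \<forall>x\<in>M. \<forall>y\<in>M. d (\<phi> g x) (\<phi> g y) = d x y)"

definition properly_discontinuous :: "'g monoid \<Rightarrow> ('g \<Rightarrow> 'a \<Rightarrow> 'a) \<Rightarrow> bool" where
  "properly_discontinuous G \<phi> \<longleftrightarrow>
     (\<forall>K L. compactin mtopology K \<and> compactin mtopology L \<longrightarrow>
        finite {g \<in> carrier G. \<phi> g ` K \<inter> L \<noteq> {}})"

definition cocompact_action :: "'g monoid \<Rightarrow> ('g \<Rightarrow> 'a \<Rightarrow> 'a) \<Rightarrow> bool" where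
  "cocompact_action G \<phi> \<longleftrightarrow>
     (\<exists>K. compactin mtopology K \<and> (\<Union>g\<in>carrier G. \<phi> g ` K) = M)"

end

definition locally_compact_group :: "'g monoid \<Rightarrow> 'g topology \<Rightarrow> bool" where
  "locally_compact_group \<G> T \<longleftrightarrow>
     group \<G> \<and> topspace T = carrier \<G> \<and>
     continuous_map (prod_topology T T) T (\<lambda>(x, y). x \<otimes>\<^bsub>\<G>\<^esub> y) \<and>
     continuous_map T T (\<lambda>x. inv\<^bsub>\<G>\<^esub> x) \<and>
     Hausdorff_space T \<and> locally_compact_space T"

definition coset_space :: "'g monoid \<Rightarrow> 'g topology \<Rightarrow> 'g set \<Rightarrow> 'g set topology" where
  "coset_space \<G> T H =
     topology (\<lambda>U. U \<subseteq> lcosets\<^bsub>\<G>\<^esub> H \<and> openin T {g \<in> topspace T. g <#\<^bsub>\<G>\<^esub> H \<in> U})"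

lemma openin_coset_space:
  "openin (coset_space \<G> T H) U \<longleftrightarrow>
     U \<subseteq> lcosets\<^bsub>\<G>\<^esub> H \<and> openin T {g \<in> topspace T. g <#\<^bsub>\<G>\<^esub> H \<in> U}"
proof -
  let ?P = "\<lambda>U. U \<subseteq> lcosets\<^bsub>\<G>\<^esub> H \<and> openin T {g \<in> topspace T. g <#\<^bsub>\<G>\<^esub> H \<in> U}"
  have "?P (U \<inter> V)" if "?P U" "?P V" for U V
  proof -
    have "{g \<in> topspace T. g <#\<^bsub>\<G>\<^esub> H \<in> U \<inter> V} =
          {g \<in> topspace T. g <#\<^bsub>\<G>\<^esub> H \<in> U} \<inter> {g \<in> topspace T. g <#\<^bsub>\<G>\<^esub> H \<in> V}"
      by blast
    with that show ?thesis by auto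
  qed
  moreover have "?P (\<Union>\<U>)" if "\<forall>U\<in>\<U>. ?P U" for \<U>
  proof -
    have "{g \<in> topspace T. g <#\<^bsub>\<G>\<^esub> H \<in> \<Union>\<U>} =
          (\<Union>U\<in>\<U>. {g \<in> topspace T. g <#\<^bsub>\<G>\<^esub> H \<in> U})"
      by blast
    with that show ?thesis by auto
  qed
  ultimately have "istopology ?P"
    unfolding istopology_def by blast
  then show ?thesis
    by (simp add: coset_space_def)
qed

lemma quotient_map_coset_space:
  assumes "topspace T = carrier \<G>"
  shows "quotient_map T (coset_space \<G> T H) (\<lambda>g. g <#\<^bsub>\<G>\<^esub> H)"
proof -
  have "{g \<in> topspace T. g <#\<^bsub>\<G>\<^esub> H \<in> lcosets\<^bsub>\<G>\<^esub> H} = topspace T"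
    using assms by (auto simp: LCOSETS_def)
  then have "openin (coset_space \<G> T H) (lcosets\<^bsub>\<G>\<^esub> H)"
    by (simp add: openin_coset_space)
  then have "topspace (coset_space \<G> T H) = lcosets\<^bsub>\<G>\<^esub> H"
    using openin_coset_space openin_subset openin_topspace by (metis subset_antisym)
  then show ?thesis
    using assms by (auto simp: quotient_map_def openin_coset_space LCOSETS_def)
qed

definition discrete_subgroup :: "'g set \<Rightarrow> 'g monoid \<Rightarrow> 'g topology \<Rightarrow> bool" where
  "discrete_subgroup H \<G> T \<longleftrightarrow> subgroup H \<G> \<and> subtopology T H = discrete_topology H"

definition cocompact_subgroup :: "'g set \<Rightarrow> 'g monoid \<Rightarrow> 'g topology \<Rightarrow> bool" where
  "cocompact_subgroup H \<G> T \<longleftrightarrow> subgroup H \<G> \<and> compact_space (coset_space \<G> T H)"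

definition discrete_cocompact_finite_kernel_rep ::
    "'a monoid \<Rightarrow> 'g monoid \<Rightarrow> 'g topology \<Rightarrow> ('a \<Rightarrow> 'g) \<Rightarrow> bool" where
  "discrete_cocompact_finite_kernel_rep G \<G> T \<rho> \<longleftrightarrow>
     \<rho> \<in> hom G \<G> \<and> finite (kernel G \<G> \<rho>) \<and>
     discrete_subgroup (\<rho> ` carrier G) \<G> T \<and> cocompact_subgroup (\<rho> ` carrier G) \<G> T"

text \<open>
  An existential quantifier over spaces or groups ranges over a fixed type of points, so the
  conditions are indexed by that type. The space is required to be nonempty: every group acts
  properly discontinuously and cocompactly on the empty space.
\<close>

definition common_model_space :: "'x itself \<Rightarrow> 'a monoid set \<Rightarrow> bool" where
  "common_model_space _ \<C> \<longleftrightarrow>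
     (\<exists>(X :: 'x set) d. Metric_space X d \<and> X \<noteq> {} \<and>
        Metric_space.proper_metric_space X d \<and> Metric_space.coarse_geodesic_space X d \<and>
        (\<forall>G\<in>\<C>. \<exists>\<phi>. Metric_space.isometric_action X d G \<phi> \<and>
           Metric_space.properly_discontinuous X d G \<phi> \<and>
           Metric_space.cocompact_action X d G \<phi>))"

definition common_locally_compact_group :: "'g itself \<Rightarrow> 'a monoid set \<Rightarrow> bool" where
  "common_locally_compact_group _ \<C> \<longleftrightarrow>
     (\<exists>(\<G> :: 'g monoid) T. locally_compact_group \<G> T \<and>
        (\<forall>G\<in>\<C>. \<exists>\<rho>. discrete_cocompact_finite_kernel_rep G \<G> T \<rho>))"

text \<open>
  In an equivalence of the two conditions, the hypothesis of each implication should allow an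
  arbitrary type of points, whereas its conclusion has to name one. The type \<open>nat set\<close> will do:
  it has the cardinality of the continuum, and a nonempty proper metric space and its isometry
  group have at most that many elements. Taking \<open>nat set\<close> throughout gives a plain equivalence.
\<close>

end

theory Submission
  imports Defs "HOL-Algebra.Weak_Morphisms"
begin

text \<open>
  From a space to a group: the isometry group of a nonempty proper metric space \<open>X\<close>, with the
  topology of pointwise convergence, is locally compact, because the isometries displacing a base
  point by at most \<open>r\<close> lie in a compact set (\<open>compactin_isometries_bounded\<close>). A properly
  discontinuous cocompact action on \<open>X\<close> is a homomorphism into this group; proper discontinuity
  makes its kernel finite and its image discrete, and cocompactness of the action makes the image
  cocompact (\<open>action_imp_rep_isometry_group\<close>). As \<open>X\<close> is separable, an isometry is described by
  countably many reals, so the group can be copied to the type \<open>nat set\<close>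
  (\<open>ex_transported_group\<close>).

  From a group to a space: the group \<open>G\<close> need not be metrizable, but it suffices to find a
  left-invariant pseudometric and to pass to its metric quotient. If the collection is nonempty,
  then \<open>G\<close> contains a finitely generated cocompact subgroup, hence is generated by a compact
  symmetric set \<open>W\<close>. Let \<open>f\<close> be a continuous function with values in \<open>[0, 1]\<close>, supported in \<open>W\<close>, with
  value \<open>1\<close> at the identity. The displacement \<open>osc s = sup\<^sub>x \<bar>f x - f (s\<inverse> x)\<bar>\<close> is a length function,
  small near the identity, and less than \<open>1\<close> only on \<open>W\<close>. The length \<open>len g\<close> is the infimum of
  \<open>osc s\<^sub>1 + \<dots> + osc s\<^sub>n\<close> over all factorisations \<open>g = s\<^sub>1 \<cdots> s\<^sub>n\<close> with factors in \<open>W\<close>. Merging cheap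
  neighbouring factors bounds \<open>n\<close> in terms of the cost (\<open>reach_imp_bounded_word\<close>), so balls are
  relatively compact; cutting a factorisation after a prefix of bounded cost (\<open>reach_prefix\<close>)
  yields first steps of nearly geodesic paths, and compactness turns them into exact coarse
  geodesics (\<open>coarse_geodesic_space_if_splits\<close>). The discrete cocompact subgroups act on the
  quotient by left translation (\<open>rep_acts_on_points\<close>).
\<close>

section \<open>Coding sequences of reals by sets of natural numbers\<close>

lemma inj_code_real_sequences: "\<exists>c :: (nat \<Rightarrow> real) \<Rightarrow> nat set. inj c"
proof
  \<comment> \<open>A real is determined by the rationals above it, so a sequence by countably many bits.\<close>
  let ?c = "\<lambda>a :: nat \<Rightarrow> real. to_nat ` {(i :: nat, q :: rat). a i < of_rat q}"
  show "inj ?c"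
  proof (rule injI)
    fix a b :: "nat \<Rightarrow> real"
    assume "?c a = ?c b"
    then have eq: "{(i :: nat, q :: rat). a i < of_rat q} = {(i, q). b i < of_rat q}"
      by (simp add: inj_image_eq_iff)
    have iff: "a i < of_rat q \<longleftrightarrow> b i < of_rat q" for i q
    proof -
      have "(i, q) \<in> {(i :: nat, q :: rat). a i < of_rat q} \<longleftrightarrow> (i, q) \<in> {(i, q). b i < of_rat q}"
        unfolding eq ..
      then show ?thesis by simp
    qed
    show "a = b"
    proof
      fix i
      show "a i = b i"
      proof (rule linorder_cases[of "a i" "b i"])
        assume "a i < b i"
        then obtain q where "a i < of_rat q" "of_rat q < b i"
          using of_rat_dense by blast
        with iff[of i q] show ?thesis by simp
      next
        assume "b i < a i"
        then obtain q where "b i < of_rat q" "of_rat q < a i"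
          using of_rat_dense by blast
        with iff[of i q] show ?thesis by simp
      qed
    qed
  qed
qed

section \<open>Locally compact groups and their discrete cocompact subgroups\<close>

text \<open>Locally compact groups as a locale extending \<open>group\<close>.\<close>

locale lc_group =
  fixes G :: "'g monoid" (structure) and T :: "'g topology"
  assumes locally_compact_group: "locally_compact_group G T"
begin

sublocale group G
  using locally_compact_group by (simp add: locally_compact_group_def)

lemma topspace_eq [simp]: "topspace T = carrier G"
  using locally_compact_group by (simp add: locally_compact_group_def)

lemma Hausdorff: "Hausdorff_space T"
  using locally_compact_group by (simp add: locally_compact_group_def)

lemma locally_compact: "locally_compact_space T"
  using locally_compact_group by (simp add: locally_compact_group_def)

lemma continuous_map_mult:
  assumes "continuous_map Y T f" "continuous_map Y T g"
  shows "continuous_map Y T (\<lambda>y. f y \<otimes> g y)"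
proof -
  have "continuous_map Y T ((\<lambda>(x, y). x \<otimes> y) \<circ> (\<lambda>y. (f y, g y)))"
    using locally_compact_group assms
    by (intro continuous_map_compose[where X' = "prod_topology T T"])
       (auto simp: locally_compact_group_def continuous_map_pairwise o_def)
  then show ?thesis by (simp add: o_def)
qed

lemma continuous_map_inverse:
  assumes "continuous_map Y T f"
  shows "continuous_map Y T (\<lambda>y. inv f y)"
proof -
  have "continuous_map Y T ((\<lambda>x. inv x) \<circ> f)"
    using locally_compact_group assms
    by (intro continuous_map_compose[where X' = T]) (auto simp: locally_compact_group_def)
  then show ?thesis by (simp add: o_def)
qed

lemma continuous_map_left_translation:
  "a \<in> carrier G \<Longrightarrow> continuous_map T T (\<lambda>x. a \<otimes> x)"
  by (intro continuous_map_mult) auto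

lemma continuous_map_right_translation:
  "a \<in> carrier G \<Longrightarrow> continuous_map T T (\<lambda>x. x \<otimes> a)"
  by (intro continuous_map_mult) auto

lemma openin_left_translation:
  assumes "openin T U" "a \<in> carrier G"
  shows "openin T {x \<in> carrier G. a \<otimes> x \<in> U}"
  using openin_continuous_map_preimage[OF continuous_map_left_translation assms(1)] assms(2)
  by simp

lemma openin_right_translation:
  assumes "openin T U" "a \<in> carrier G"
  shows "openin T {x \<in> carrier G. x \<otimes> a \<in> U}"
  using openin_continuous_map_preimage[OF continuous_map_right_translation assms(1)] assms(2)
  by simp

lemma compactin_set_mult:
  assumes "compactin T A" "compactin T B"
  shows "compactin T (A <#> B)"
proof -
  have "continuous_map (prod_topology T T) T (\<lambda>z. fst z \<otimes> snd z)"
    by (intro continuous_map_mult continuous_map_fst continuous_map_snd)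
  moreover have "compactin (prod_topology T T) (A \<times> B)"
    using assms by (simp add: compactin_Times)
  ultimately have "compactin T ((\<lambda>z. fst z \<otimes> snd z) ` (A \<times> B))"
    by (rule image_compactin[rotated])
  moreover have "(\<lambda>z. fst z \<otimes> snd z) ` (A \<times> B) = A <#> B"
    by (force simp: set_mult_def image_iff)
  ultimately show ?thesis by simp
qed

lemma compactin_inverse:
  assumes "compactin T A"
  shows "compactin T ((\<lambda>x. inv x) ` A)"
  using assms image_compactin continuous_map_inverse[OF continuous_map_id] by (fastforce simp: id_def)

text \<open>
  Compactness of the coset space \<open>G/H\<close> is restated inside \<open>G\<close>, as the existence of a compact set
  meeting every coset. This form is easy to carry along an isomorphism and to compare with
  cocompactness of an action.
\<close>

lemma cocompact_subgroup_iff: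
  assumes H: "subgroup H G"
  shows "cocompact_subgroup H G T \<longleftrightarrow> (\<exists>Q. compactin T Q \<and> carrier G \<subseteq> Q <#> H)"
proof
  let ?\<pi> = "\<lambda>g. g <# H"
  have quot: "quotient_map T (coset_space G T H) ?\<pi>"
    by (rule quotient_map_coset_space) simp
  have img: "?\<pi> ` carrier G = topspace (coset_space G T H)"
    using quot by (simp add: quotient_map_def)
  have HG: "H \<subseteq> carrier G"
    using H by (rule subgroup.subset)
  {
    assume "cocompact_subgroup H G T"
    then have comp: "compact_space (coset_space G T H)"
      by (simp add: cocompact_subgroup_def)
    have "\<forall>x\<in>carrier G. \<exists>U K. openin T U \<and> compactin T K \<and> x \<in> U \<and> U \<subseteq> K"
      using locally_compact by (simp add: locally_compact_space_def)
    then obtain U K where UK: "\<And>x. x \<in> carrier G \<Longrightarrow>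
        openin T (U x) \<and> compactin T (K x) \<and> x \<in> U x \<and> U x \<subseteq> K x"
      by metis
    have Usub: "U x \<subseteq> carrier G" if "x \<in> carrier G" for x
      using UK[OF that] openin_subset by fastforce
    \<comment> \<open>The projection is open, because the saturation of \<open>U x\<close> is a union of right translates.\<close>
    have op: "openin (coset_space G T H) (?\<pi> ` U x)" if x: "x \<in> carrier G" for x
    proof -
      have "{g \<in> topspace T. g <# H \<in> ?\<pi> ` U x} = (\<Union>h\<in>H. {g \<in> carrier G. g \<otimes> h \<in> U x})"
      proof (intro equalityI subsetI)
        fix g assume "g \<in> {g \<in> topspace T. g <# H \<in> ?\<pi> ` U x}"
        then obtain u where g: "g \<in> carrier G" and u: "u \<in> U x" "g <# H = u <# H" by auto
        have uG: "u \<in> carrier G" using u(1) Usub[OF x] by auto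
        have "u \<in> g <# H"
          using u uG H by (metis lcos_self)
        then obtain h where "h \<in> H" "u = g \<otimes> h" by (auto simp: l_coset_def)
        then show "g \<in> (\<Union>h\<in>H. {g \<in> carrier G. g \<otimes> h \<in> U x})"
          using u g by auto
      next
        fix g assume "g \<in> (\<Union>h\<in>H. {g \<in> carrier G. g \<otimes> h \<in> U x})"
        then obtain h where h: "h \<in> H" and g: "g \<in> carrier G" and u: "g \<otimes> h \<in> U x" by auto
        have "g \<otimes> h \<in> g <# H" using h by (auto simp: l_coset_def)
        then have "g <# H = (g \<otimes> h) <# H"
          using l_repr_independence[OF _ g H] by blast
        then show "g \<in> {g \<in> topspace T. g <# H \<in> ?\<pi> ` U x}"
          using u g by auto
      qed
      moreover have "openin T (\<Union>h\<in>H. {g \<in> carrier G. g \<otimes> h \<in> U x})"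
        using UK[OF x] HG by (intro openin_Union) (auto intro!: openin_right_translation)
      ultimately show ?thesis
        using Usub[OF x] by (auto simp: openin_coset_space LCOSETS_def)
    qed
    have "compactin (coset_space G T H) (?\<pi> ` carrier G)"
      using comp by (simp add: compact_space_def img)
    moreover have "\<forall>V\<in>(\<lambda>x. ?\<pi> ` U x) ` carrier G. openin (coset_space G T H) V"
      using op by blast
    moreover have "?\<pi> ` carrier G \<subseteq> \<Union>((\<lambda>x. ?\<pi> ` U x) ` carrier G)"
      using UK by blast
    ultimately have "\<exists>\<F>. finite \<F> \<and> \<F> \<subseteq> (\<lambda>x. ?\<pi> ` U x) ` carrier G \<and>
            topspace (coset_space G T H) \<subseteq> \<Union>\<F>"
      unfolding compactin_def img by (metis (no_types, lifting))
    then obtain \<F> where \<F>: "finite \<F>" "\<F> \<subseteq> (\<lambda>x. ?\<pi> ` U x) ` carrier G"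
        "topspace (coset_space G T H) \<subseteq> \<Union>\<F>" by blast
    then obtain F where F: "finite F" "F \<subseteq> carrier G" "\<F> = (\<lambda>x. ?\<pi> ` U x) ` F"
      by (metis finite_subset_image)
    have "compactin T (\<Union>x\<in>F. K x)"
      using F UK by (intro compactin_Union) auto
    moreover have "carrier G \<subseteq> (\<Union>x\<in>F. K x) <#> H"
    proof
      fix g assume g: "g \<in> carrier G"
      then have "g <# H \<in> \<Union>\<F>" using \<F>(3) img by blast
      then obtain x u where x: "x \<in> F" and u: "u \<in> U x" "g <# H = u <# H" using F(3) by auto
      have "g \<in> u <# H" using g H u(2) by (metis lcos_self)
      then obtain h where "h \<in> H" "g = u \<otimes> h" by (auto simp: l_coset_def)
      moreover have "u \<in> (\<Union>x\<in>F. K x)" using x u UK F(2) by blast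
      ultimately show "g \<in> (\<Union>x\<in>F. K x) <#> H" by (auto simp: set_mult_def)
    qed
    ultimately show "\<exists>Q. compactin T Q \<and> carrier G \<subseteq> Q <#> H" by blast
  next
    assume "\<exists>Q. compactin T Q \<and> carrier G \<subseteq> Q <#> H"
    then obtain Q where Q: "compactin T Q" "carrier G \<subseteq> Q <#> H" by blast
    have QG: "Q \<subseteq> carrier G" using compactin_subset_topspace[OF Q(1)] by simp
    have "?\<pi> ` Q = topspace (coset_space G T H)"
    proof
      show "?\<pi> ` Q \<subseteq> topspace (coset_space G T H)" using QG img by blast
      show "topspace (coset_space G T H) \<subseteq> ?\<pi> ` Q"
      proof
        fix A assume "A \<in> topspace (coset_space G T H)"
        then obtain g where g: "g \<in> carrier G" "A = g <# H" using img by auto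
        then obtain q h where q: "q \<in> Q" "h \<in> H" "g = q \<otimes> h"
          using Q(2) by (auto simp: set_mult_def)
        then have "g \<in> q <# H" by (auto simp: l_coset_def)
        then have "q <# H = g <# H" using l_repr_independence[OF _ _ H] q(1) QG by blast
        then show "A \<in> ?\<pi> ` Q" using g q by auto
      qed
    qed
    moreover have "compactin (coset_space G T H) (?\<pi> ` Q)"
      using quotient_imp_continuous_map[OF quot] Q(1) by (rule image_compactin[rotated])
    ultimately show "cocompact_subgroup H G T"
      using H by (simp add: cocompact_subgroup_def compact_space_def)
  }
qed

lemma finite_compact_Int_discrete_subgroup:
  assumes H: "discrete_subgroup H G T" and K: "compactin T K"
  shows "finite (K \<inter> H)"
proof -
  have sub: "subgroup H G" and disc: "subtopology T H = discrete_topology H"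
    using H by (auto simp: discrete_subgroup_def)
  have HG: "H \<subseteq> carrier G" using sub by (rule subgroup.subset)
  have "openin (subtopology T H) {\<one>}"
    using disc subgroup.one_closed[OF sub] by simp
  then obtain U where U: "openin T U" "{\<one>} = U \<inter> H"
    by (auto simp: openin_subtopology)
  \<comment> \<open>Each \<open>g\<close> has a neighbourhood \<open>N g\<close> with \<open>(N g)\<inverse> \<cdot> N g \<subseteq> U\<close>, which meets \<open>H\<close> at most once.\<close>
  have "\<exists>N. openin T N \<and> g \<in> N \<and> (\<forall>x\<in>N. \<forall>y\<in>N. inv x \<otimes> y \<in> U)" if g: "g \<in> carrier G" for g
  proof -
    have "continuous_map (prod_topology T T) T (\<lambda>z. inv (fst z) \<otimes> snd z)"
      by (intro continuous_map_mult continuous_map_inverse continuous_map_fst continuous_map_snd)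
    then have "openin (prod_topology T T)
        {z \<in> topspace (prod_topology T T). inv (fst z) \<otimes> snd z \<in> U}"
      by (rule openin_continuous_map_preimage) (rule U(1))
    moreover have "(g, g) \<in> {z \<in> topspace (prod_topology T T). inv (fst z) \<otimes> snd z \<in> U}"
      using g U(2) by auto
    ultimately have "\<exists>A B. openin T A \<and> openin T B \<and> g \<in> A \<and> g \<in> B \<and>
        A \<times> B \<subseteq> {z \<in> topspace (prod_topology T T). inv (fst z) \<otimes> snd z \<in> U}"
      unfolding openin_prod_topology_alt by (elim allE impE)
    then obtain A B where AB: "openin T A" "openin T B" "g \<in> A" "g \<in> B"
        "A \<times> B \<subseteq> {z \<in> topspace (prod_topology T T). inv (fst z) \<otimes> snd z \<in> U}"
      by (elim exE conjE)
    have "inv x \<otimes> y \<in> U" if "x \<in> A" "y \<in> B" for x y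
    proof -
      have "(x, y) \<in> A \<times> B" using that by simp
      then show ?thesis using AB(5) by fastforce
    qed
    with AB show ?thesis
      by (intro exI[of _ "A \<inter> B"]) (simp add: openin_Int)
  qed
  then obtain N where N: "\<And>g. g \<in> carrier G \<Longrightarrow>
      openin T (N g) \<and> g \<in> N g \<and> (\<forall>x\<in>N g. \<forall>y\<in>N g. inv x \<otimes> y \<in> U)"
    by metis
  have KG: "K \<subseteq> carrier G" using compactin_subset_topspace[OF K] by simp
  have "K \<subseteq> \<Union>(N ` K)" "\<forall>V\<in>N ` K. openin T V" using N KG by auto
  then obtain F where F: "finite F" "F \<subseteq> N ` K" "K \<subseteq> \<Union>F"
    using K unfolding compactin_def by meson
  have "finite (V \<inter> H)" if V: "V \<in> F" for V
  proof -
    obtain g where g: "g \<in> K" "V = N g" using F V by blast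
    have "x = y" if "x \<in> V \<inter> H" "y \<in> V \<inter> H" for x y
    proof -
      have "inv x \<otimes> y \<in> U \<inter> H"
        using that g N KG sub by (auto intro: subgroup.m_closed subgroup.m_inv_closed)
      then have "inv x \<otimes> y = \<one>" using U(2) by blast
      moreover have "x \<in> carrier G" "y \<in> carrier G" using that HG by auto
      then have "y = x \<otimes> (inv x \<otimes> y)" by (simp add: m_assoc[symmetric])
      ultimately show "x = y" using \<open>x \<in> carrier G\<close> by simp
    qed
    then have "V \<inter> H = {} \<or> (\<exists>z. V \<inter> H = {z})" by blast
    then show ?thesis by auto
  qed
  then have "finite (\<Union>V\<in>F. V \<inter> H)" using F(1) by blast
  moreover have "K \<inter> H \<subseteq> (\<Union>V\<in>F. V \<inter> H)" using F(3) by blast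
  ultimately show ?thesis by (rule finite_subset[rotated])
qed

end

section \<open>Transport of a locally compact group along an injection\<close>

lemma (in lc_group) ex_transported_group:
  fixes c :: "'g \<Rightarrow> 'h"
  assumes inj: "inj_on c (carrier G)"
  shows "\<exists>(G' :: 'h monoid) T'. locally_compact_group G' T' \<and>
    (\<forall>(A :: 'a monoid) \<rho>. group A \<and> discrete_cocompact_finite_kernel_rep A G T \<rho> \<longrightarrow>
       discrete_cocompact_finite_kernel_rep A G' T' (c \<circ> \<rho>))"
proof -
  let ?G' = "image_group c G"
  \<comment> \<open>The topology on the image is the one that makes \<open>c\<close> a homeomorphism.\<close>
  define dec where "dec = inv_into (carrier G) c"
  define T' where "T' = pullback_topology (c ` carrier G) dec T"
  have dec [simp]: "dec (c x) = x" if "x \<in> carrier G" for x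
    using that inj by (simp add: dec_def inv_into_f_f)
  have carr: "carrier ?G' = c ` carrier G" by (simp add: image_group_def)
  have mult': "x \<otimes>\<^bsub>?G'\<^esub> y = c (dec x \<otimes> dec y)" for x y
    by (simp add: image_group_def dec_def)
  have grp: "group ?G'"
    using inj by (rule inj_imp_image_group_is_group)
  have hom: "c \<in> hom G ?G'"
    using inj_imp_image_group_iso[OF inj] by (simp add: iso_def)
  interpret c: group_hom G ?G' c
    using grp hom by (intro group_hom.intro group_hom_axioms.intro is_group)
  have top': "topspace T' = c ` carrier G"
    by (auto simp: T'_def topspace_pullback_topology)
  have cont_dec: "continuous_map T' T dec"
    using continuous_map_pullback[OF continuous_map_id, of "c ` carrier G" dec T]
    by (simp add: T'_def)
  have cont_c: "continuous_map T T' c"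
    unfolding T'_def
  proof (rule continuous_map_pullback')
    show "continuous_map T T (dec \<circ> c)"
      by (rule continuous_map_eq[OF continuous_map_id]) simp
  qed auto
  have hms: "homeomorphic_maps T T' c dec"
    using cont_dec cont_c by (auto simp: homeomorphic_maps_def top')
  then have homeo: "T homeomorphic_space T'"
    by (auto simp: homeomorphic_space_def)
  have mult_cont: "continuous_map (prod_topology T' T') T' (\<lambda>(x, y). x \<otimes>\<^bsub>?G'\<^esub> y)"
  proof -
    have "continuous_map (prod_topology T' T') T (\<lambda>z. dec (fst z) \<otimes> dec (snd z))"
      by (intro continuous_map_mult continuous_map_compose[OF _ cont_dec, unfolded o_def]
          continuous_map_fst continuous_map_snd)
    from continuous_map_compose[OF this cont_c] show ?thesis
      by (simp add: o_def mult' case_prod_unfold)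
  qed
  have inv_cont: "continuous_map T' T' (\<lambda>x. inv\<^bsub>?G'\<^esub> x)"
  proof -
    have "continuous_map T' T' (c \<circ> (\<lambda>x. inv (dec x)))"
      by (intro continuous_map_compose[OF _ cont_c] continuous_map_inverse cont_dec)
    then show ?thesis
      by (rule continuous_map_eq) (auto simp: top')
  qed
  have lc': "locally_compact_group ?G' T'"
    unfolding locally_compact_group_def
    using grp top' carr mult_cont inv_cont Hausdorff locally_compact
      homeomorphic_Hausdorff_space[OF homeo] homeomorphic_locally_compact_space[OF homeo]
    by simp
  interpret G': lc_group ?G' T'
    using lc' by unfold_locales
  have op_c: "openin T' (c ` V)" if "openin T V" for V
  proof -
    have "open_map T T' c"
      using hms by (simp add: homeomorphic_maps_map homeomorphic_imp_open_map)
    then show ?thesis using that by (simp add: open_map_def)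
  qed
  have "discrete_cocompact_finite_kernel_rep A ?G' T' (c \<circ> \<rho>)"
    if A: "group A" and rep: "discrete_cocompact_finite_kernel_rep A G T \<rho>"
    for A :: "'a monoid" and \<rho>
  proof -
    let ?H = "\<rho> ` carrier A"
    have \<rho>: "\<rho> \<in> hom A G" and fin: "finite (kernel A G \<rho>)"
      and disc: "subtopology T ?H = discrete_topology ?H"
      and sub: "subgroup ?H G" and coc: "cocompact_subgroup ?H G T"
      using rep by (auto simp: discrete_cocompact_finite_kernel_rep_def discrete_subgroup_def)
    have HG: "?H \<subseteq> carrier G" using sub by (rule subgroup.subset)
    have img: "(c \<circ> \<rho>) ` carrier A = c ` ?H" by (simp add: image_comp)
    have hom': "c \<circ> \<rho> \<in> hom A ?G'" using \<rho> hom by (auto simp: hom_def Pi_iff)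
    have sub': "subgroup (c ` ?H) ?G'" using sub by (rule c.subgroup_img_is_subgroup)
    have "kernel A ?G' (c \<circ> \<rho>) = kernel A G \<rho>"
    proof -
      have "c (\<rho> x) = \<one>\<^bsub>?G'\<^esub> \<longleftrightarrow> \<rho> x = \<one>" if "x \<in> carrier A" for x
      proof -
        have "\<rho> x \<in> carrier G" using that HG by blast
        then have "c (\<rho> x) = c \<one> \<longleftrightarrow> \<rho> x = \<one>"
          by (intro inj_on_eq_iff[OF inj] one_closed)
        then show ?thesis by (simp only: c.hom_one)
      qed
      then show ?thesis by (auto simp: kernel_def)
    qed
    then have fin': "finite (kernel A ?G' (c \<circ> \<rho>))" using fin by simp
    have "subtopology T' (c ` ?H) = discrete_topology (c ` ?H)"
    proof (rule sym, subst discrete_topology_unique, intro conjI ballI)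
      show "topspace (subtopology T' (c ` ?H)) = c ` ?H"
        using HG by (auto simp: top' topspace_subtopology)
      fix y assume "y \<in> c ` ?H"
      then obtain h where h: "h \<in> ?H" "y = c h" by blast
      then have "openin (subtopology T ?H) {h}" using disc by simp
      then obtain V where V: "openin T V" "{h} = V \<inter> ?H" by (auto simp: openin_subtopology)
      then have VG: "V \<subseteq> carrier G" using openin_subset by fastforce
      have "{y} = c ` V \<inter> c ` ?H"
        using V(2) h inj_on_image_Int[OF inj VG HG] by (metis image_empty image_insert)
      then show "openin (subtopology T' (c ` ?H)) {y}"
        using op_c[OF V(1)] by (auto simp: openin_subtopology)
    qed
    moreover have "cocompact_subgroup (c ` ?H) ?G' T'"
    proof -
      obtain Q where Q: "compactin T Q" "carrier G \<subseteq> Q <#> ?H"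
        using coc cocompact_subgroup_iff[OF sub] by blast
      have "compactin T' (c ` Q)" using Q(1) cont_c by (rule image_compactin)
      moreover have "carrier ?G' \<subseteq> c ` Q <#>\<^bsub>?G'\<^esub> c ` ?H"
      proof
        fix y assume "y \<in> carrier ?G'"
        then obtain g where g: "g \<in> carrier G" "y = c g" by (auto simp: carr)
        have "g \<in> Q <#> ?H" using Q(2) g(1) by blast
        then obtain q h where "q \<in> Q" "h \<in> ?H" "g = q \<otimes> h"
          unfolding set_mult_def by blast
        moreover have "Q \<subseteq> carrier G" using compactin_subset_topspace[OF Q(1)] by simp
        ultimately have "y = c q \<otimes>\<^bsub>?G'\<^esub> c h" using g HG c.hom_mult by blast
        then show "y \<in> c ` Q <#>\<^bsub>?G'\<^esub> c ` ?H"
          using \<open>q \<in> Q\<close> \<open>h \<in> ?H\<close> by (auto simp: set_mult_def)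
      qed
      ultimately show ?thesis using G'.cocompact_subgroup_iff[OF sub'] by blast
    qed
    ultimately show ?thesis
      using hom' fin' sub'
      unfolding discrete_cocompact_finite_kernel_rep_def discrete_subgroup_def img by blast
  qed
  with lc' show ?thesis by blast
qed

section \<open>The isometry group of a proper metric space\<close>

lemma compactin_pullback_topology:
  assumes "compactin P (e ` S)" "S \<subseteq> A"
  shows "compactin (pullback_topology A e P) S"
  unfolding compactin_def
proof (intro conjI allI impI)
  show "S \<subseteq> topspace (pullback_topology A e P)"
    using assms compactin_subset_topspace by (fastforce simp: topspace_pullback_topology)
  fix \<U> assume \<U>: "(\<forall>U\<in>\<U>. openin (pullback_topology A e P) U) \<and> S \<subseteq> \<Union>\<U>"
  then have "\<forall>U\<in>\<U>. \<exists>V. openin P V \<and> U = e -` V \<inter> A"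
    by (simp add: openin_pullback_topology)
  then obtain V where V: "\<And>U. U \<in> \<U> \<Longrightarrow> openin P (V U) \<and> U = e -` V U \<inter> A" by metis
  have "e ` S \<subseteq> \<Union>(V ` \<U>)" "\<forall>W\<in>V ` \<U>. openin P W" using \<U> V by blast+
  then obtain \<F> where \<F>: "finite \<F>" "\<F> \<subseteq> V ` \<U>" "e ` S \<subseteq> \<Union>\<F>"
    using assms(1) unfolding compactin_def by meson
  then obtain \<G> where \<G>: "finite \<G>" "\<G> \<subseteq> \<U>" "\<F> = V ` \<G>" by (metis finite_subset_image)
  have "S \<subseteq> \<Union>\<G>"
  proof
    fix x assume x: "x \<in> S"
    then obtain U where "U \<in> \<G>" "e x \<in> V U" using \<F>(3) \<G>(3) by blast
    then have "x \<in> e -` V U \<inter> A" using x assms(2) by blast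
    then show "x \<in> \<Union>\<G>" using V \<open>U \<in> \<G>\<close> \<G>(2) by blast
  qed
  then show "\<exists>\<F>. finite \<F> \<and> \<F> \<subseteq> \<U> \<and> S \<subseteq> \<Union>\<F>" using \<G> by blast
qed

context Metric_space
begin

lemma continuous_map_d:
  assumes "continuous_map Y mtopology f" "continuous_map Y mtopology g"
  shows "continuous_map Y euclideanreal (\<lambda>y. d (f y) (g y))"
  using continuous_map_mdist[of Y "metric (M, d)" f g] assms by (simp add: mtopology_of)

lemma proper_imp_countable_dense:
  assumes "proper_metric_space" "M \<noteq> {}"
  shows "\<exists>s :: nat \<Rightarrow> 'a. range s \<subseteq> M \<and> (\<forall>x\<in>M. \<forall>\<epsilon>>0. \<exists>i. d (s i) x < \<epsilon>)"
proof -
  obtain x0 where x0: "x0 \<in> M" using assms(2) by blast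
  have "\<exists>K. finite K \<and> K \<subseteq> mcball x0 (real n) \<and>
          mcball x0 (real n) \<subseteq> (\<Union>x\<in>K. mball x (1 / real (Suc m)))" for n m
    using compactin_imp_mtotally_bounded assms(1) x0
    by (simp add: proper_metric_space_def mtotally_bounded_def)
  then obtain K where K: "\<And>n m. finite (K n m)" "\<And>n m. K n m \<subseteq> mcball x0 (real n)"
      "\<And>n m. mcball x0 (real n) \<subseteq> (\<Union>x\<in>K n m. mball x (1 / real (Suc m)))"
    by metis
  define D where "D = insert x0 (\<Union>n m. K n m)"
  have "countable D" "D \<noteq> {}"
    unfolding D_def by (intro countable_insert countable_UN countable_finite K(1) countableI_type) simp
  then have D: "range (from_nat_into D) = D" by (simp add: range_from_nat_into)
  have "K n m \<subseteq> M" for n m using K(2)[of n m] by (rule order_trans) auto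
  then have "D \<subseteq> M" using x0 by (auto simp: D_def)
  moreover have "\<exists>i. d (from_nat_into D i) x < \<epsilon>" if x: "x \<in> M" and \<epsilon>: "\<epsilon> > 0" for x \<epsilon>
  proof -
    obtain m where m: "1 / real (Suc m) < \<epsilon>" using \<epsilon> nat_approx_posE by blast
    obtain n where "d x0 x \<le> real n" using real_arch_simple by blast
    then have "x \<in> mcball x0 (real n)" using x x0 by simp
    then obtain y where y: "y \<in> K n m" "x \<in> mball y (1 / real (Suc m))" using K(3) by blast
    then have "y \<in> D" by (auto simp: D_def)
    then obtain i where "y = from_nat_into D i" using D by (metis imageE)
    then show ?thesis using y m by (intro exI[of _ i]) simp
  qed
  ultimately show ?thesis using D by (intro exI[of _ "from_nat_into D"]) auto
qed

text \<open>
  Surjective isometries of \<open>M\<close>, taken to be undefined outside \<open>M\<close> so that they form a subgroup of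
  \<open>BijGroup M\<close>, in which actions take their values.
\<close>

definition isometries :: "('a \<Rightarrow> 'a) set" where
  "isometries = {f \<in> Bij M. \<forall>x\<in>M. \<forall>y\<in>M. d (f x) (f y) = d x y}"

text \<open>The group of isometries under composition.\<close>

definition isometry_group :: "('a \<Rightarrow> 'a) monoid" where
  "isometry_group = BijGroup M \<lparr>carrier := isometries\<rparr>"

text \<open>
  The values of an isometry (index \<open>True\<close>) and of its inverse (index \<open>False\<close>), as a point of the
  product of copies of \<open>M\<close> indexed by \<open>UNIV \<times> M\<close>.
\<close>

definition isometry_graph :: "('a \<Rightarrow> 'a) \<Rightarrow> bool \<times> 'a \<Rightarrow> 'a" where
  "isometry_graph f = (\<lambda>(b, x) \<in> UNIV \<times> M. if b then f x else (inv\<^bsub>isometry_group\<^esub> f) x)"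

text \<open>
  The topology of pointwise convergence of an isometry together with its inverse. Recording the
  inverse makes the image of the isometry group closed in the product, because a pair of maps
  \<open>f\<close>, \<open>g\<close> consists of an isometry and its inverse exactly if \<open>d (f x) y = d x (g y)\<close> throughout.
\<close>

definition isometry_topology :: "('a \<Rightarrow> 'a) topology" where
  "isometry_topology =
     pullback_topology isometries isometry_graph (product_topology (\<lambda>_. mtopology) (UNIV \<times> M))"

lemma subgroup_isometries: "subgroup isometries (BijGroup M)"
proof -
  interpret B: group "BijGroup M" by (rule group_BijGroup)
  show ?thesis
  proof (rule B.subgroupI)
    show "isometries \<subseteq> carrier (BijGroup M)" by (auto simp: isometries_def BijGroup_def)
    have "(\<lambda>x\<in>M. x) \<in> isometries" by (simp add: isometries_def id_Bij)
    then show "isometries \<noteq> {}" by blast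
    fix f assume f: "f \<in> isometries"
    then have fB: "f \<in> Bij M" by (simp add: isometries_def)
    then have im: "f ` M = M" by (simp add: Bij_def bij_betw_def)
    have "d (inv_into M f x) (inv_into M f y) = d x y" if "x \<in> M" "y \<in> M" for x y
    proof -
      have "d (f (inv_into M f x)) (f (inv_into M f y)) = d (inv_into M f x) (inv_into M f y)"
        using f that im by (simp add: isometries_def inv_into_into)
      then show ?thesis using that im by (simp add: f_inv_into_f)
    qed
    then show "inv\<^bsub>BijGroup M\<^esub> f \<in> isometries"
      using fB by (simp add: inv_BijGroup isometries_def restrict_inv_into_Bij)
    fix g assume g: "g \<in> isometries"
    then have gB: "g \<in> Bij M" by (simp add: isometries_def)
    then have "g x \<in> M" if "x \<in> M" for x using that Bij_imp_funcset by blast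
    then show "f \<otimes>\<^bsub>BijGroup M\<^esub> g \<in> isometries"
      using f g fB gB by (simp add: BijGroup_def isometries_def compose_Bij compose_eq)
  qed
qed

lemma group_isometry_group: "group isometry_group"
  unfolding isometry_group_def
  using subgroup_isometries group_BijGroup by (rule subgroup.subgroup_is_group)

lemma carrier_isometry_group [simp]: "carrier isometry_group = isometries"
  by (simp add: isometry_group_def)

lemma isometries_mem: "f \<in> isometries \<Longrightarrow> x \<in> M \<Longrightarrow> f x \<in> M"
  by (rule funcset_mem[OF Bij_imp_funcset]) (simp_all add: isometries_def)

lemma isometries_dist:
  "f \<in> isometries \<Longrightarrow> x \<in> M \<Longrightarrow> y \<in> M \<Longrightarrow> d (f x) (f y) = d x y"
  by (simp add: isometries_def)

lemma isometries_eqI: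
  "f \<in> isometries \<Longrightarrow> g \<in> isometries \<Longrightarrow> (\<And>x. x \<in> M \<Longrightarrow> f x = g x) \<Longrightarrow> f = g"
  by (rule extensionalityI[of f M g]) (simp_all add: isometries_def Bij_def)

lemma mult_isometry_group:
  assumes "f \<in> isometries" "g \<in> isometries" "x \<in> M"
  shows "(f \<otimes>\<^bsub>isometry_group\<^esub> g) x = f (g x)"
  using assms by (simp add: isometry_group_def BijGroup_def isometries_def compose_eq)

lemma one_isometry_group: "x \<in> M \<Longrightarrow> \<one>\<^bsub>isometry_group\<^esub> x = x"
  by (simp add: isometry_group_def BijGroup_def)

lemma inv_isometries [simp]: "f \<in> isometries \<Longrightarrow> inv\<^bsub>isometry_group\<^esub> f \<in> isometries"
  using group.inv_closed[OF group_isometry_group] by simp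

lemma inv_isometry_group:
  assumes "f \<in> isometries" "x \<in> M"
  shows "(inv\<^bsub>isometry_group\<^esub> f) (f x) = x" "f ((inv\<^bsub>isometry_group\<^esub> f) x) = x"
  using assms group.l_inv[OF group_isometry_group, of f] group.r_inv[OF group_isometry_group, of f]
    mult_isometry_group[of "inv\<^bsub>isometry_group\<^esub> f" f x]
    mult_isometry_group[of f "inv\<^bsub>isometry_group\<^esub> f" x]
  by (simp_all add: one_isometry_group)

lemma isometry_graph_eq [simp]:
  assumes "x \<in> M"
  shows "isometry_graph f (True, x) = f x"
    and "isometry_graph f (False, x) = (inv\<^bsub>isometry_group\<^esub> f) x"
  using assms by (auto simp: isometry_graph_def)

lemma isometry_graph_mem:
  assumes "f \<in> isometries"
  shows "isometry_graph f \<in> UNIV \<times> M \<rightarrow>\<^sub>E M"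
  using isometries_mem[OF assms] isometries_mem[OF inv_isometries[OF assms]]
  by (auto simp: isometry_graph_def)

lemma topspace_isometry_topology [simp]: "topspace isometry_topology = isometries"
  using isometry_graph_mem by (auto simp: isometry_topology_def topspace_pullback_topology)

lemma continuous_map_into_isometry_topology:
  "continuous_map Y isometry_topology h \<longleftrightarrow>
     h \<in> topspace Y \<rightarrow> isometries \<and>
     (\<forall>x\<in>M. continuous_map Y mtopology (\<lambda>y. h y x)) \<and>
     (\<forall>x\<in>M. continuous_map Y mtopology (\<lambda>y. (inv\<^bsub>isometry_group\<^esub> (h y)) x))"
    (is "?L \<longleftrightarrow> ?R")
proof -
  let ?P = "product_topology (\<lambda>_ :: bool \<times> 'a. mtopology) (UNIV \<times> M)"
  have graph: "continuous_map Y ?P (isometry_graph \<circ> h) \<longleftrightarrow>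
     (\<forall>x\<in>M. continuous_map Y mtopology (\<lambda>y. h y x)) \<and>
     (\<forall>x\<in>M. continuous_map Y mtopology (\<lambda>y. (inv\<^bsub>isometry_group\<^esub> (h y)) x))"
  proof -
    have ext: "(isometry_graph \<circ> h) ` topspace Y \<subseteq> extensional (UNIV \<times> M)"
      by (auto simp: isometry_graph_def)
    have "(\<forall>k\<in>UNIV \<times> M. continuous_map Y mtopology (\<lambda>y. (isometry_graph \<circ> h) y k)) \<longleftrightarrow>
      (\<forall>x\<in>M. continuous_map Y mtopology (\<lambda>y. (isometry_graph \<circ> h) y (True, x)) \<and>
        continuous_map Y mtopology (\<lambda>y. (isometry_graph \<circ> h) y (False, x)))"
      unfolding Ball_def split_paired_All all_bool_eq by simp blast
    also have "\<dots> \<longleftrightarrow> (\<forall>x\<in>M. continuous_map Y mtopology (\<lambda>y. h y x)) \<and>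
      (\<forall>x\<in>M. continuous_map Y mtopology (\<lambda>y. (inv\<^bsub>isometry_group\<^esub> (h y)) x))"
      by auto
    finally show ?thesis
      using ext unfolding continuous_map_componentwise by (auto simp: image_subset_iff_funcset)
  qed
  show ?thesis
  proof
    assume L: ?L
    then have "h \<in> topspace Y \<rightarrow> isometries"
      using continuous_map_funspace by fastforce
    moreover have "continuous_map isometry_topology ?P isometry_graph"
      using continuous_map_pullback[OF continuous_map_id, of isometries isometry_graph ?P]
      by (simp add: isometry_topology_def)
    then have "continuous_map Y ?P (isometry_graph \<circ> h)"
      using L by (rule continuous_map_compose[rotated])
    ultimately show ?R using graph by blast
  next
    assume ?R
    then show ?L
      unfolding isometry_topology_def
      using graph by (intro continuous_map_pullback') auto
  qed
qed

text \<open>Isometries are equicontinuous, so evaluation is jointly continuous.\<close>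

lemma continuous_map_evaluation:
  assumes "continuous_map Y isometry_topology h" "continuous_map Y mtopology p"
  shows "continuous_map Y mtopology (\<lambda>y. h y (p y))"
  unfolding continuous_map_to_metric
proof (intro ballI allI impI)
  fix y and \<epsilon> :: real assume y: "y \<in> topspace Y" and \<epsilon>: "\<epsilon> > 0"
  have h: "h z \<in> isometries" if "z \<in> topspace Y" for z
    using assms(1) that by (auto simp: continuous_map_into_isometry_topology)
  note hM = isometries_mem[OF h]
  have p: "p z \<in> M" if "z \<in> topspace Y" for z
    using assms(2) that continuous_map_funspace by fastforce
  have "continuous_map Y mtopology (\<lambda>z. h z (p y))"
    using assms(1) p[OF y] by (simp add: continuous_map_into_isometry_topology)
  then obtain U where U: "openin Y U" "y \<in> U" "\<forall>z\<in>U. h z (p y) \<in> mball (h y (p y)) (\<epsilon> / 2)"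
    using y \<epsilon> unfolding continuous_map_to_metric by (meson half_gt_zero)
  obtain V where V: "openin Y V" "y \<in> V" "\<forall>z\<in>V. p z \<in> mball (p y) (\<epsilon> / 2)"
    using assms(2) y \<epsilon> unfolding continuous_map_to_metric by (meson half_gt_zero)
  have "h z (p z) \<in> mball (h y (p y)) \<epsilon>" if z: "z \<in> U \<inter> V" for z
  proof -
    have zY: "z \<in> topspace Y" using z U(1) openin_subset by blast
    have "d (h y (p y)) (h z (p z)) \<le> d (h y (p y)) (h z (p y)) + d (h z (p y)) (h z (p z))"
      using hM p y zY by (intro triangle) auto
    also have "d (h z (p y)) (h z (p z)) = d (p y) (p z)"
      using p y zY by (intro isometries_dist h) auto
    also have "d (h y (p y)) (h z (p y)) + d (p y) (p z) < \<epsilon> / 2 + \<epsilon> / 2"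
      using z U V by (intro add_strict_mono) auto
    finally show ?thesis using hM p y zY by simp
  qed
  then show "\<exists>U. openin Y U \<and> y \<in> U \<and> (\<forall>z\<in>U. h z (p z) \<in> mball (h y (p y)) \<epsilon>)"
    using U V by (intro exI[of _ "U \<inter> V"]) auto
qed

lemma continuous_map_isometry_inverse:
  assumes "continuous_map Y isometry_topology h"
  shows "continuous_map Y isometry_topology (\<lambda>y. inv\<^bsub>isometry_group\<^esub> (h y))"
proof -
  have h: "h y \<in> isometries" if "y \<in> topspace Y" for y
    using assms that by (auto simp: continuous_map_into_isometry_topology)
  have "continuous_map Y mtopology (\<lambda>y. (inv\<^bsub>isometry_group\<^esub> (inv\<^bsub>isometry_group\<^esub> (h y))) x)"
    if x: "x \<in> M" for x
  proof (rule continuous_map_eq)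
    show "continuous_map Y mtopology (\<lambda>y. h y x)"
      using assms x by (simp add: continuous_map_into_isometry_topology)
  qed (use h group.inv_inv[OF group_isometry_group] in auto)
  then show ?thesis
    using assms h by (simp add: continuous_map_into_isometry_topology Pi_iff)
qed

lemma continuous_map_isometry_mult:
  assumes f: "continuous_map Y isometry_topology f" and g: "continuous_map Y isometry_topology g"
  shows "continuous_map Y isometry_topology (\<lambda>y. f y \<otimes>\<^bsub>isometry_group\<^esub> g y)"
proof -
  interpret I: group isometry_group by (rule group_isometry_group)
  have fI: "f y \<in> isometries" and gI: "g y \<in> isometries" if "y \<in> topspace Y" for y
    using f g that by (auto simp: continuous_map_into_isometry_topology)
  have 1: "continuous_map Y mtopology (\<lambda>y. (f y \<otimes>\<^bsub>isometry_group\<^esub> g y) x)"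
    if fg: "continuous_map Y isometry_topology f" "continuous_map Y isometry_topology g"
      and x: "x \<in> M" for f g x
  proof (rule continuous_map_eq)
    show "continuous_map Y mtopology (\<lambda>y. f y (g y x))"
      using fg(1)
    proof (rule continuous_map_evaluation)
      show "continuous_map Y mtopology (\<lambda>y. g y x)"
        using fg(2) x by (simp add: continuous_map_into_isometry_topology)
    qed
    fix y assume "y \<in> topspace Y"
    then have "f y \<in> isometries" "g y \<in> isometries"
      using fg unfolding continuous_map_into_isometry_topology by blast+
    then show "f y (g y x) = (f y \<otimes>\<^bsub>isometry_group\<^esub> g y) x"
      using x by (simp add: mult_isometry_group)
  qed
  have "continuous_map Y mtopology (\<lambda>y. (inv\<^bsub>isometry_group\<^esub> (f y \<otimes>\<^bsub>isometry_group\<^esub> g y)) x)"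
    if x: "x \<in> M" for x
  proof (rule continuous_map_eq)
    show "continuous_map Y mtopology
        (\<lambda>y. (inv\<^bsub>isometry_group\<^esub> (g y) \<otimes>\<^bsub>isometry_group\<^esub> inv\<^bsub>isometry_group\<^esub> (f y)) x)"
      using f g x by (intro 1 continuous_map_isometry_inverse)
  qed (use fI gI in \<open>simp add: I.inv_mult_group\<close>)
  moreover have "f y \<otimes>\<^bsub>isometry_group\<^esub> g y \<in> isometries" if "y \<in> topspace Y" for y
    using I.m_closed[of "f y" "g y"] fI gI that by simp
  ultimately show ?thesis
    using 1[OF f g] by (auto simp: continuous_map_into_isometry_topology)
qed

lemma Hausdorff_isometry_topology: "Hausdorff_space isometry_topology"
proof (rule Hausdorff_space_injective_preimage)
  let ?P = "product_topology (\<lambda>_ :: bool \<times> 'a. mtopology) (UNIV \<times> M)"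
  show "Hausdorff_space ?P"
    using Hausdorff_space_mtopology by (simp add: Hausdorff_space_product_topology)
  show "continuous_map isometry_topology ?P isometry_graph"
    using continuous_map_pullback[OF continuous_map_id, of isometries isometry_graph ?P]
    by (simp add: isometry_topology_def)
  show "inj_on isometry_graph (topspace isometry_topology)"
  proof (rule inj_onI)
    fix f g assume fg: "f \<in> topspace isometry_topology" "g \<in> topspace isometry_topology"
      and eq: "isometry_graph f = isometry_graph g"
    have "f x = g x" if "x \<in> M" for x
      using isometry_graph_eq(1)[OF that] eq by metis
    then show "f = g" using fg by (intro isometries_eqI) auto
  qed
qed

lemma isometry_graph_image:
  assumes p: "p \<in> UNIV \<times> M \<rightarrow>\<^sub>E M"
    and adj: "\<And>x y. x \<in> M \<Longrightarrow> y \<in> M \<Longrightarrow> d (p (True, x)) y = d x (p (False, y))"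
  shows "\<exists>f\<in>isometries. p = isometry_graph f"
proof -
  define f where "f = (\<lambda>x\<in>M. p (True, x))"
  define g where "g = (\<lambda>x\<in>M. p (False, x))"
  have fM: "f x \<in> M" and gM: "g x \<in> M" if "x \<in> M" for x
    using p that by (auto simp: f_def g_def)
  have adj': "d (f x) y = d x (g y)" if "x \<in> M" "y \<in> M" for x y
    using adj that by (simp add: f_def g_def)
  have gf: "g (f x) = x" if "x \<in> M" for x
    using adj'[of x "f x"] that fM gM by (metis mdist_zero zero)
  have fg: "f (g x) = x" if "x \<in> M" for x
    using adj'[of "g x" x] that fM gM by (metis mdist_zero zero)
  have bij: "bij_betw f M M"
    by (rule bij_betw_byWitness[of _ g]) (use gf fg fM gM in auto)
  have fI: "f \<in> isometries"
    using bij adj' fM gf by (auto simp: isometries_def Bij_def f_def)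
  have "(inv\<^bsub>isometry_group\<^esub> f) x = g x" if "x \<in> M" for x
    using inv_isometry_group(1)[OF fI, of "g x"] that gM fg by simp
  then have "p k = isometry_graph f k" for k
  proof (cases k)
    case (Pair b x)
    then show ?thesis
      using p \<open>\<And>x. x \<in> M \<Longrightarrow> (inv\<^bsub>isometry_group\<^esub> f) x = g x\<close>
      by (cases b; cases "x \<in> M")
        (auto simp: f_def g_def isometry_graph_def PiE_def extensional_def)
  qed
  then show ?thesis using fI by blast
qed

text \<open>
  The Arzela--Ascoli property of a proper space: isometries that displace a point by a bounded
  amount lie in a product of compact balls.
\<close>

lemma compactin_isometries_bounded:
  assumes proper: "proper_metric_space" and x0: "x0 \<in> M"
  shows "\<exists>K. compactin isometry_topology K \<and> {f \<in> isometries. d (f x0) x0 \<le> r} \<subseteq> K"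
proof -
  let ?P = "product_topology (\<lambda>_ :: bool \<times> 'a. mtopology) (UNIV \<times> M)"
  define C where "C = (\<Pi>\<^sub>E k\<in>(UNIV :: bool set) \<times> M. mcball x0 (r + d x0 (snd k)))"
  define K where "K = {f \<in> isometries. isometry_graph f \<in> C}"
  have compC: "compactin ?P C"
    using proper x0 by (auto simp: C_def compactin_PiE proper_metric_space_def)
  have CM: "C \<subseteq> UNIV \<times> M \<rightarrow>\<^sub>E M"
    unfolding C_def by (intro PiE_mono) auto
  define A where "A x y = {p \<in> topspace ?P. d (p (True, x)) y - d x (p (False, y)) \<in> {0}}" for x y
  have closedA: "closedin ?P (A x y)" if "x \<in> M" "y \<in> M" for x y
  proof -
    have "continuous_map ?P euclideanreal (\<lambda>p. d (p (True, x)) y - d x (p (False, y)))"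
      using that
      by (intro continuous_map_diff continuous_map_d continuous_map_product_projection) auto
    then show ?thesis unfolding A_def by (rule closedin_continuous_map_preimage) simp
  qed
  have "isometry_graph ` K = C \<inter> (\<Inter>x\<in>M. \<Inter>y\<in>M. A x y)"
  proof (intro equalityI subsetI)
    fix p assume "p \<in> isometry_graph ` K"
    then obtain f where f: "f \<in> isometries" "p = isometry_graph f" "p \<in> C" by (auto simp: K_def)
    have "d (f x) y = d x ((inv\<^bsub>isometry_group\<^esub> f) y)" if "x \<in> M" "y \<in> M" for x y
      using isometries_dist[OF f(1), of x "(inv\<^bsub>isometry_group\<^esub> f) y"] inv_isometry_group[OF f(1)]
        that isometries_mem[OF inv_isometries[OF f(1)]] by simp
    moreover have "p \<in> topspace ?P" using f(3) CM by auto
    ultimately have "p \<in> A x y" if "x \<in> M" "y \<in> M" for x y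
      using that unfolding A_def f(2) by simp
    then show "p \<in> C \<inter> (\<Inter>x\<in>M. \<Inter>y\<in>M. A x y)" using f by blast
  next
    fix p assume p: "p \<in> C \<inter> (\<Inter>x\<in>M. \<Inter>y\<in>M. A x y)"
    then have "\<exists>f\<in>isometries. p = isometry_graph f"
      using CM by (intro isometry_graph_image) (auto simp: A_def)
    then show "p \<in> isometry_graph ` K" using p by (auto simp: K_def)
  qed
  moreover have "compactin ?P (C \<inter> (\<Inter>x\<in>M. \<Inter>y\<in>M. A x y))"
    using x0 closedA by (intro compact_Int_closedin[OF compC] closedin_Inter) auto
  ultimately have "compactin isometry_topology K"
    unfolding isometry_topology_def by (intro compactin_pullback_topology) (auto simp: K_def)
  moreover have "{f \<in> isometries. d (f x0) x0 \<le> r} \<subseteq> K"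
  proof clarify
    fix f assume f: "f \<in> isometries" and r: "d (f x0) x0 \<le> r"
    note fM = isometries_mem[OF f] and gM = isometries_mem[OF inv_isometries[OF f]]
    have "d x0 (f x) \<le> r + d x0 x" if "x \<in> M" for x
    proof -
      have "d x0 (f x) \<le> d x0 (f x0) + d (f x0) (f x)"
        using that fM x0 by (intro triangle)
      then show ?thesis using r isometries_dist[OF f x0 that] by (simp add: commute)
    qed
    moreover have "d x0 ((inv\<^bsub>isometry_group\<^esub> f) x) \<le> r + d x0 x" if "x \<in> M" for x
    proof -
      have "d x0 ((inv\<^bsub>isometry_group\<^esub> f) x) = d (f x0) x"
        using isometries_dist[OF f, of x0 "(inv\<^bsub>isometry_group\<^esub> f) x"] inv_isometry_group[OF f]
          that gM x0 by simp
      also have "\<dots> \<le> d (f x0) x0 + d x0 x" using that fM x0 by (intro triangle)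
      finally show ?thesis using r by simp
    qed
    ultimately have "isometry_graph f \<in> C"
      using fM gM x0 by (auto simp: C_def isometry_graph_def)
    then show "f \<in> K" using f by (simp add: K_def)
  qed
  ultimately show ?thesis by blast
qed

lemma locally_compact_isometry_group:
  assumes proper: "proper_metric_space" and ne: "M \<noteq> {}"
  shows "locally_compact_group isometry_group isometry_topology"
proof -
  obtain x0 where x0: "x0 \<in> M" using ne by blast
  have ev: "continuous_map isometry_topology mtopology (\<lambda>f. f x0)"
    using continuous_map_into_isometry_topology[of isometry_topology id] x0 by simp
  have "locally_compact_space isometry_topology"
    unfolding locally_compact_space_def
  proof
    fix f assume "f \<in> topspace isometry_topology"
    then have f: "f \<in> isometries" by simp
    let ?U = "{h \<in> topspace isometry_topology. h x0 \<in> mball (f x0) 1}"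
    have "openin isometry_topology ?U"
      using ev by (rule openin_continuous_map_preimage) simp
    moreover have "f \<in> ?U" using isometries_mem[OF f x0] f by simp
    moreover obtain K where "compactin isometry_topology K"
        "{h \<in> isometries. d (h x0) x0 \<le> d (f x0) x0 + 1} \<subseteq> K"
      using compactin_isometries_bounded[OF proper x0] by blast
    moreover have "?U \<subseteq> {h \<in> isometries. d (h x0) x0 \<le> d (f x0) x0 + 1}"
    proof clarsimp
      fix h assume h: "h \<in> isometries" "d (f x0) (h x0) < 1"
      have "d (h x0) x0 \<le> d (h x0) (f x0) + d (f x0) x0"
        by (rule triangle[OF isometries_mem[OF h(1) x0] isometries_mem[OF f x0] x0])
      then show "d (h x0) x0 \<le> d (f x0) x0 + 1" using h by (simp add: commute)
    qed
    ultimately show "\<exists>U K. openin isometry_topology U \<and> compactin isometry_topology K \<and>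
        f \<in> U \<and> U \<subseteq> K"
      by (intro exI[of _ ?U] exI[of _ K] conjI) (assumption | rule order_trans)+
  qed
  moreover have "continuous_map (prod_topology isometry_topology isometry_topology)
      isometry_topology (\<lambda>(f, g). f \<otimes>\<^bsub>isometry_group\<^esub> g)"
    unfolding case_prod_beta
    by (intro continuous_map_isometry_mult continuous_map_fst continuous_map_snd)
  moreover have "continuous_map isometry_topology isometry_topology (\<lambda>f. inv\<^bsub>isometry_group\<^esub> f)"
    using continuous_map_isometry_inverse[OF continuous_map_id] by simp
  ultimately show ?thesis
    using group_isometry_group Hausdorff_isometry_topology
    by (simp add: locally_compact_group_def)
qed

end

section \<open>Actions as representations in the isometry group\<close>

context Metric_space
begin

lemma ex_inj_code_isometries:
  assumes "proper_metric_space" "M \<noteq> {}"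
  shows "\<exists>c :: ('a \<Rightarrow> 'a) \<Rightarrow> nat set. inj_on c isometries"
proof -
  obtain s :: "nat \<Rightarrow> 'a" where s: "range s \<subseteq> M"
      and dense: "\<And>x \<epsilon>. x \<in> M \<Longrightarrow> \<epsilon> > 0 \<Longrightarrow> \<exists>i. d (s i) x < \<epsilon>"
    using proper_imp_countable_dense[OF assms] by blast
  obtain c :: "(nat \<Rightarrow> real) \<Rightarrow> nat set" where c: "inj c"
    using inj_code_real_sequences by blast
  \<comment> \<open>An isometry is determined by the distances \<open>d (s i) (f (s j))\<close>.\<close>
  define e where "e f = (\<lambda>n. d (s (fst (prod_decode n))) (f (s (snd (prod_decode n)))))" for f
  have sM: "s i \<in> M" for i using s by blast
  have "inj_on e isometries"
  proof (rule inj_onI)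
    fix f g assume f: "f \<in> isometries" and g: "g \<in> isometries" and eq: "e f = e g"
    note fM = isometries_mem[OF f] and gM = isometries_mem[OF g]
    have eq': "d (s i) (f (s j)) = d (s i) (g (s j))" for i j
      using fun_cong[OF eq, of "prod_encode (i, j)"] by (simp add: e_def)
    have small: "d (f x) (g x) < 4 * \<epsilon>" if x: "x \<in> M" and \<epsilon>: "\<epsilon> > 0" for x \<epsilon>
    proof -
      obtain j where j: "d (s j) x < \<epsilon>" using dense[OF x \<epsilon>] by blast
      obtain i where i: "d (s i) (f (s j)) < \<epsilon>" using dense[OF fM[OF sM] \<epsilon>] by blast
      have "d (f x) (g x) \<le> d (f x) (f (s j)) + d (f (s j)) (g x)"
        by (rule triangle[OF fM[OF x] fM[OF sM] gM[OF x]])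
      moreover have "d (f (s j)) (g x) \<le> d (f (s j)) (g (s j)) + d (g (s j)) (g x)"
        by (rule triangle[OF fM[OF sM] gM[OF sM] gM[OF x]])
      moreover have "d (f (s j)) (g (s j)) \<le> d (f (s j)) (s i) + d (s i) (g (s j))"
        by (rule triangle[OF fM[OF sM] sM gM[OF sM]])
      moreover have "d (f x) (f (s j)) < \<epsilon>"
        using j isometries_dist[OF f x sM] by (simp add: commute)
      moreover have "d (g (s j)) (g x) < \<epsilon>"
        using j isometries_dist[OF g sM x] by simp
      moreover have "d (s i) (g (s j)) < \<epsilon>" using i eq' by simp
      moreover have "d (f (s j)) (s i) < \<epsilon>" using i by (simp add: commute)
      ultimately show ?thesis by linarith
    qed
    have "f x = g x" if x: "x \<in> M" for x
    proof (rule ccontr)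
      assume "f x \<noteq> g x"
      then have "d (f x) (g x) > 0" using fM[OF x] gM[OF x] by simp
      then show False using small[OF x, of "d (f x) (g x) / 4"] by simp
    qed
    then show "f = g" using f g by (rule isometries_eqI[rotated 2])
  qed
  then have "inj_on (c \<circ> e) isometries"
    using c by (intro comp_inj_on) (auto intro: inj_on_subset)
  then show ?thesis by blast
qed

lemma action_imp_rep_isometry_group:
  assumes proper: "proper_metric_space" and ne: "M \<noteq> {}"
    and act: "isometric_action G \<phi>" "properly_discontinuous G \<phi>" "cocompact_action G \<phi>"
  shows "discrete_cocompact_finite_kernel_rep G isometry_group isometry_topology \<phi>"
proof -
  interpret group_action G M \<phi> using act(1) by (simp add: isometric_action_def)
  interpret GH: group_hom G "BijGroup M" \<phi> by (rule group_hom)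
  interpret I: lc_group isometry_group isometry_topology
    using locally_compact_isometry_group[OF proper ne] by unfold_locales
  have \<phi>I: "\<phi> g \<in> isometries" if "g \<in> carrier G" for g
    using GH.hom_closed[OF that] act(1) that
    by (auto simp: isometries_def isometric_action_def BijGroup_def)
  let ?H = "\<phi> ` carrier G"
  have HI: "?H \<subseteq> isometries" using \<phi>I by blast
  have hom: "\<phi> \<in> hom G isometry_group"
    using \<phi>I GH.hom_mult by (auto simp: hom_def isometry_group_def)
  interpret GI: group_hom G isometry_group \<phi>
    using hom by (intro group_hom.intro group_hom_axioms.intro GH.G.is_group I.is_group)
  have sub: "subgroup ?H isometry_group" by (rule GI.img_is_subgroup)
  obtain x0 where x0: "x0 \<in> M" using ne by blast
  have fin: "finite {g \<in> carrier G. d (\<phi> g x0) y \<le> r}" if y: "y \<in> M" for y r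
  proof -
    have "compactin mtopology {x0}" "compactin mtopology (mcball y r)"
      using x0 y proper by (auto simp: proper_metric_space_def)
    then have "finite {g \<in> carrier G. \<phi> g ` {x0} \<inter> mcball y r \<noteq> {}}"
      using act(2) unfolding properly_discontinuous_def by blast
    moreover have "{g \<in> carrier G. d (\<phi> g x0) y \<le> r} \<subseteq>
        {g \<in> carrier G. \<phi> g ` {x0} \<inter> mcball y r \<noteq> {}}"
    proof clarsimp
      fix g assume "g \<in> carrier G" "d (\<phi> g x0) y \<le> r"
      then show "\<phi> g x0 \<in> M \<and> y \<in> M \<and> d y (\<phi> g x0) \<le> r"
        using isometries_mem[OF \<phi>I x0] y by (simp add: commute)
    qed
    ultimately show ?thesis by (rule finite_subset[rotated])
  qed
  have "kernel G isometry_group \<phi> \<subseteq> {g \<in> carrier G. d (\<phi> g x0) x0 \<le> 0}"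
    using x0 by (auto simp: kernel_def one_isometry_group)
  then have ker: "finite (kernel G isometry_group \<phi>)"
    using fin[OF x0] by (rule finite_subset)
  \<comment> \<open>Only finitely many elements of the image are close to a given one, and points are closed.\<close>
  have "subtopology isometry_topology ?H = discrete_topology ?H"
  proof (rule sym, subst discrete_topology_unique, intro conjI ballI)
    show "topspace (subtopology isometry_topology ?H) = ?H" using HI by auto
    fix f assume f: "f \<in> ?H"
    then have fI: "f \<in> isometries" using HI by blast
    let ?U = "{h \<in> topspace isometry_topology. h x0 \<in> mball (f x0) 1}"
    have "continuous_map isometry_topology mtopology (\<lambda>h. h x0)"
      using continuous_map_into_isometry_topology[of isometry_topology id] x0 by simp
    then have U: "openin isometry_topology ?U"
      by (rule openin_continuous_map_preimage) simp
    have "?U \<inter> ?H \<subseteq> \<phi> ` {g \<in> carrier G. d (\<phi> g x0) (f x0) \<le> 1}"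
      by (auto simp: commute)
    then have finU: "finite (?U \<inter> ?H - {f})"
      using fin[OF isometries_mem[OF fI x0]] by (meson finite_Diff finite_imageI finite_subset)
    have "closedin isometry_topology (?U \<inter> ?H - {f})"
      using Hausdorff_imp_t1_space[OF Hausdorff_isometry_topology] finU
      unfolding t1_space_closedin_finite by blast
    then have "openin isometry_topology (?U - (?U \<inter> ?H - {f}))"
      using U by (intro openin_diff)
    moreover have "{f} = (?U - (?U \<inter> ?H - {f})) \<inter> ?H"
      using f fI isometries_mem[OF fI x0] by auto
    ultimately show "openin (subtopology isometry_topology ?H) {f}"
      unfolding openin_subtopology by blast
  qed
  moreover have "cocompact_subgroup ?H isometry_group isometry_topology"
  proof -
    obtain K where K: "compactin mtopology K" "(\<Union>g\<in>carrier G. \<phi> g ` K) = M"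
      using act(3) unfolding cocompact_action_def by blast
    have KM: "K \<subseteq> M" using compactin_subset_topspace[OF K(1)] by simp
    have "mbounded (insert x0 K)"
      using compactin_imp_mbounded[OF K(1)] x0 by (simp add: mbounded_insert)
    then obtain r where r: "\<And>k. k \<in> K \<Longrightarrow> d x0 k \<le> r"
      unfolding mbounded_alt by blast
    obtain Q where Q: "compactin isometry_topology Q"
        "{f \<in> isometries. d (f x0) x0 \<le> r} \<subseteq> Q"
      using compactin_isometries_bounded[OF proper x0] by blast
    have "isometries \<subseteq> Q <#>\<^bsub>isometry_group\<^esub> ?H"
    proof
      fix f assume f: "f \<in> isometries"
      let ?f' = "inv\<^bsub>isometry_group\<^esub> f"
      have "?f' x0 \<in> M" using isometries_mem[OF inv_isometries[OF f] x0] .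
      then obtain g k where g: "g \<in> carrier G" and k: "k \<in> K" "?f' x0 = \<phi> g k"
        using K(2) by blast
      have kM: "k \<in> M" using k KM by blast
      let ?q = "f \<otimes>\<^bsub>isometry_group\<^esub> \<phi> g"
      have qI: "?q \<in> isometries" using I.m_closed[of f "\<phi> g"] f \<phi>I[OF g] by simp
      \<comment> \<open>As \<open>?q\<close> maps the point \<open>k\<close> of \<open>K\<close> to \<open>x0\<close>, it moves \<open>x0\<close> by at most \<open>r\<close>.\<close>
      have "?q k = x0"
        using mult_isometry_group[OF f \<phi>I[OF g] kM] k(2) inv_isometry_group(2)[OF f x0] by simp
      then have "d (?q x0) x0 = d x0 k"
        using isometries_dist[OF qI x0 kM] by simp
      also have "\<dots> \<le> r" using r k by auto
      finally have "?q \<in> Q" using Q qI by blast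
      moreover have "inv\<^bsub>isometry_group\<^esub> (\<phi> g) \<in> ?H"
        using sub g by (intro subgroup.m_inv_closed) auto
      moreover have "f = ?q \<otimes>\<^bsub>isometry_group\<^esub> inv\<^bsub>isometry_group\<^esub> (\<phi> g)"
        using f \<phi>I[OF g] by (simp add: I.m_assoc)
      ultimately show "f \<in> Q <#>\<^bsub>isometry_group\<^esub> ?H"
        unfolding set_mult_def by blast
    qed
    then show ?thesis using Q(1) I.cocompact_subgroup_iff[OF sub] by auto
  qed
  ultimately show ?thesis
    using hom ker sub
    by (simp add: discrete_cocompact_finite_kernel_rep_def discrete_subgroup_def)
qed

end

lemma common_model_space_imp_common_locally_compact_group:
  assumes groups: "\<forall>G\<in>\<C>. group (G :: 'a monoid)" and model: "common_model_space TYPE('x) \<C>"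
  shows "common_locally_compact_group TYPE(nat set) \<C>"
proof -
  obtain X :: "'x set" and d where X: "Metric_space X d" and ne: "X \<noteq> {}"
    and proper: "Metric_space.proper_metric_space X d"
    and act: "\<And>G. G \<in> \<C> \<Longrightarrow> \<exists>\<phi>. Metric_space.isometric_action X d G \<phi> \<and>
           Metric_space.properly_discontinuous X d G \<phi> \<and>
           Metric_space.cocompact_action X d G \<phi>"
    using model unfolding common_model_space_def by blast
  interpret Metric_space X d by (rule X)
  interpret I: lc_group isometry_group isometry_topology
    using locally_compact_isometry_group[OF proper ne] by unfold_locales
  obtain c :: "('x \<Rightarrow> 'x) \<Rightarrow> nat set" where "inj_on c isometries"
    using ex_inj_code_isometries[OF proper ne] by blast
  then obtain G' :: "nat set monoid" and T' where G': "locally_compact_group G' T'"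
    and tr: "\<And>(A :: 'a monoid) \<rho>. group A \<Longrightarrow>
      discrete_cocompact_finite_kernel_rep A isometry_group isometry_topology \<rho> \<Longrightarrow>
      discrete_cocompact_finite_kernel_rep A G' T' (c \<circ> \<rho>)"
    using I.ex_transported_group[of c] unfolding carrier_isometry_group by blast
  have "\<exists>\<rho>. discrete_cocompact_finite_kernel_rep A G' T' \<rho>" if A: "A \<in> \<C>" for A
    using act[OF A] tr action_imp_rep_isometry_group[OF proper ne] groups A by blast
  then show ?thesis
    using G' unfolding common_locally_compact_group_def by blast
qed

section \<open>Coarse geodesics in proper metric spaces\<close>

lemma compactin_attains_min:
  fixes f :: "'x \<Rightarrow> real"
  assumes "compactin Y S" "S \<noteq> {}" "continuous_map Y euclideanreal f"
  shows "\<exists>x\<in>S. \<forall>y\<in>S. f x \<le> f y"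
proof -
  have "compact (f ` S)" using image_compactin[OF assms(1,3)] by simp
  then obtain m where "m \<in> f ` S" "\<forall>t\<in>f ` S. m \<le> t"
    using compact_attains_inf[of "f ` S"] assms(2) by blast
  then show ?thesis by blast
qed

text \<open>
  In a proper space it suffices to cut off a first step of bounded size with an arbitrarily small
  loss: by compactness the loss can be made zero, and every step decreases the distance
  to the end point by at least \<open>a\<close>.
\<close>

lemma (in Metric_space) coarse_geodesic_space_if_splits:
  assumes proper: "proper_metric_space" and a: "a > 0" and c: "c \<ge> 0"
    and splits: "\<And>x y \<epsilon>. \<lbrakk>x \<in> M; y \<in> M; c < d x y; \<epsilon> > 0\<rbrakk> \<Longrightarrow>
      \<exists>z\<in>M. a \<le> d x z \<and> d x z \<le> c \<and> d x z + d z y \<le> d x y + \<epsilon>"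
  shows "coarse_geodesic_space"
proof -
  have exact: "\<exists>z\<in>M. a \<le> d x z \<and> d x z \<le> c \<and> d x z + d z y = d x y"
    if x: "x \<in> M" and y: "y \<in> M" and xy: "c < d x y" for x y
  proof -
    let ?S = "mcball x c \<inter> {z \<in> topspace mtopology. d x z \<in> {a..}}"
    have cont: "continuous_map mtopology euclideanreal (\<lambda>z. d u z)" if "u \<in> M" for u
      using that continuous_map_id[of mtopology] by (intro continuous_map_d) (auto simp: id_def)
    have "closedin mtopology {z \<in> topspace mtopology. d x z \<in> {a..}}"
      using cont[OF x] by (rule closedin_continuous_map_preimage) simp
    then have "compactin mtopology ?S"
      using proper x by (intro compact_Int_closedin) (auto simp: proper_metric_space_def)
    moreover have "?S \<noteq> {}"
      using splits[OF x y xy zero_less_one] x by auto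
    moreover have "continuous_map mtopology euclideanreal (\<lambda>z. d x z + d y z)"
      using x y cont by (intro continuous_map_add)
    ultimately obtain z where z: "z \<in> ?S" and le: "\<And>w. w \<in> ?S \<Longrightarrow> d x z + d y z \<le> d x w + d y w"
      using compactin_attains_min[of mtopology ?S "\<lambda>z. d x z + d y z"] by blast
    have "d x z + d z y \<le> d x y"
    proof (rule field_le_epsilon)
      fix \<epsilon> :: real assume "\<epsilon> > 0"
      then obtain w where w: "w \<in> M" "a \<le> d x w" "d x w \<le> c" "d x w + d w y \<le> d x y + \<epsilon>"
        using splits[OF x y xy] by blast
      then have "w \<in> ?S" using x by simp
      then show "d x z + d z y \<le> d x y + \<epsilon>" using le[of w] w by (simp add: commute)
    qed
    moreover have "d x y \<le> d x z + d z y" using z x y by (intro triangle) auto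
    ultimately show ?thesis using z by (intro bexI[of _ z]) auto
  qed
  have short: "\<exists>n p. coarse_geodesic c x y n p" if "x \<in> M" "y \<in> M" "d x y \<le> c" for x y
    using that
    by (intro exI[of _ 1] exI[of _ "\<lambda>i. if i = 0 then x else y"])
      (auto simp: coarse_geodesic_def coarse_path_def path_len_def)
  have "\<exists>n p. coarse_geodesic c x y n p" if "x \<in> M" "y \<in> M" "d x y \<le> c + real k * a" for x y k
    using that
  proof (induction k arbitrary: x)
    case 0
    then show ?case by (intro short) auto
  next
    case (Suc k)
    show ?case
    proof (cases "d x y \<le> c")
      case True
      then show ?thesis using Suc.prems by (intro short)
    next
      case False
      then obtain z where z: "z \<in> M" "a \<le> d x z" "d x z \<le> c" "d x z + d z y = d x y"
        using exact[OF Suc.prems(1,2)] by auto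
      then have "d z y \<le> c + real k * a" using Suc.prems(3) by (simp add: distrib_right)
      then obtain n p where p: "coarse_geodesic c z y n p"
        using Suc.IH[OF z(1) Suc.prems(2)] by blast
      have "coarse_geodesic c x y (Suc n) (case_nat x p)"
        unfolding coarse_geodesic_def coarse_path_def
      proof (intro conjI allI impI)
        show "path_len (Suc n) (case_nat x p) = d x y"
          using p z(4)
          by (simp add: path_len_def sum.lessThan_Suc_shift coarse_geodesic_def coarse_path_def
              del: sum.lessThan_Suc)
        fix i
        show "case_nat x p i \<in> M" if "i \<le> Suc n"
          using that p Suc.prems(1)
          by (cases i) (auto simp: coarse_geodesic_def coarse_path_def)
        show "d (case_nat x p i) (case_nat x p (Suc i)) \<le> c" if "i < Suc n"
          using that p z(3)
          by (cases i) (auto simp: coarse_geodesic_def coarse_path_def)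
      qed (use p in \<open>simp_all add: coarse_geodesic_def coarse_path_def\<close>)
      then show ?thesis by blast
    qed
  qed
  moreover have "\<exists>k. d x y \<le> c + real k * a" for x y
  proof -
    obtain k where "(d x y - c) / a \<le> real k" using real_arch_simple by blast
    then show ?thesis using a by (intro exI[of _ k]) (simp add: field_simps)
  qed
  ultimately show ?thesis unfolding coarse_geodesic_space_def using c by blast
qed

section \<open>The model space of a proper length function\<close>

lemma (in group_hom) finite_preimage_of_finite_kernel:
  assumes ker: "finite (kernel G H h)" and F: "finite F"
  shows "finite {x \<in> carrier G. h x \<in> F}"
proof -
  have "finite {x \<in> carrier G. h x = y}" for y
  proof (cases "{x \<in> carrier G. h x = y} = {}")
    case False
    then obtain x0 where x0: "x0 \<in> carrier G" "h x0 = y" by blast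
    have "{x \<in> carrier G. h x = y} \<subseteq> (\<lambda>k. x0 \<otimes> k) ` kernel G H h"
    proof
      fix x assume x: "x \<in> {x \<in> carrier G. h x = y}"
      then have "inv x0 \<otimes> x \<in> kernel G H h"
        using x0 by (auto simp: kernel_def)
      moreover have "x = x0 \<otimes> (inv x0 \<otimes> x)"
        using x x0 by (simp add: G.m_assoc[symmetric])
      ultimately show "x \<in> (\<lambda>k. x0 \<otimes> k) ` kernel G H h" by blast
    qed
    then show ?thesis using ker by (meson finite_imageI finite_subset)
  next
    case True
    then show ?thesis by (metis finite.emptyI)
  qed
  then have "finite (\<Union>y\<in>F. {x \<in> carrier G. h x = y})" using F by blast
  moreover have "{x \<in> carrier G. h x \<in> F} = (\<Union>y\<in>F. {x \<in> carrier G. h x = y})" by blast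
  ultimately show ?thesis by simp
qed

text \<open>
  A length function on a locally compact group that is continuous at the identity, has relatively
  compact balls, and is coarsely geodesic up to an arbitrarily small error: from a long element
  one can split off a left factor whose length lies in \<open>[1/4, 3/2]\<close>, at a loss of at most \<open>\<epsilon>\<close>.
\<close>

locale proper_length = lc_group G T for G :: "'g monoid" (structure) and T +
  fixes len :: "'g \<Rightarrow> real"
  assumes len_nonneg: "g \<in> carrier G \<Longrightarrow> 0 \<le> len g"
    and len_one: "len \<one> = 0"
    and len_mult: "\<lbrakk>g \<in> carrier G; h \<in> carrier G\<rbrakk> \<Longrightarrow> len (g \<otimes> h) \<le> len g + len h"
    and len_inv: "g \<in> carrier G \<Longrightarrow> len (inv g) = len g"
    and len_continuous: "\<epsilon> > 0 \<Longrightarrow> \<exists>N. openin T N \<and> \<one> \<in> N \<and> (\<forall>g\<in>N. len g < \<epsilon>)"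
    and len_proper: "\<exists>K. compactin T K \<and> {g \<in> carrier G. len g \<le> r} \<subseteq> K"
    and len_splits: "\<lbrakk>g \<in> carrier G; 1 \<le> len g; \<epsilon> > 0\<rbrakk> \<Longrightarrow>
      \<exists>z\<in>carrier G. 1/4 \<le> len z \<and> len z \<le> 3/2 \<and> len z + len (inv z \<otimes> g) \<le> len g + \<epsilon>"
begin

text \<open>The left-invariant pseudometric of a length function.\<close>

definition ldist :: "'g \<Rightarrow> 'g \<Rightarrow> real" where
  "ldist g h = len (inv g \<otimes> h)"

lemma ldist_nonneg: "\<lbrakk>g \<in> carrier G; h \<in> carrier G\<rbrakk> \<Longrightarrow> 0 \<le> ldist g h"
  by (simp add: ldist_def len_nonneg)

lemma ldist_commute:
  assumes "g \<in> carrier G" "h \<in> carrier G"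
  shows "ldist g h = ldist h g"
  using len_inv[of "inv g \<otimes> h"] assms by (simp add: ldist_def inv_mult_group)

lemma ldist_triangle:
  assumes "g \<in> carrier G" "h \<in> carrier G" "k \<in> carrier G"
  shows "ldist g k \<le> ldist g h + ldist h k"
proof -
  have "inv g \<otimes> k = (inv g \<otimes> h) \<otimes> (inv h \<otimes> k)"
    using assms by (simp add: m_assoc inv_solve_left' flip: m_assoc[of h "inv h" k])
  then show ?thesis using len_mult[of "inv g \<otimes> h" "inv h \<otimes> k"] assms by (simp add: ldist_def)
qed

lemma ldist_left_invariant:
  assumes "a \<in> carrier G" "g \<in> carrier G" "h \<in> carrier G"
  shows "ldist (a \<otimes> g) (a \<otimes> h) = ldist g h"
proof -
  have "inv (a \<otimes> g) \<otimes> (a \<otimes> h) = inv g \<otimes> (inv a \<otimes> (a \<otimes> h))"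
    using assms by (simp add: inv_mult_group m_assoc)
  also have "inv a \<otimes> (a \<otimes> h) = h"
    using assms by (simp add: m_assoc[symmetric])
  finally show ?thesis by (simp add: ldist_def)
qed

lemma ldist_neighbourhood:
  assumes g: "g \<in> carrier G" and \<epsilon>: "\<epsilon> > 0"
  shows "\<exists>U. openin T U \<and> g \<in> U \<and> (\<forall>h\<in>U. ldist g h < \<epsilon>)"
proof -
  obtain N where N: "openin T N" "\<one> \<in> N" "\<forall>g\<in>N. len g < \<epsilon>" using len_continuous[OF \<epsilon>] by blast
  have "openin T {h \<in> carrier G. inv g \<otimes> h \<in> N}"
    using N(1) g by (intro openin_left_translation) auto
  then show ?thesis
    using N g by (intro exI[of _ "{h \<in> carrier G. inv g \<otimes> h \<in> N}"]) (auto simp: ldist_def)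
qed

lemma countable_ldist_dense:
  "\<exists>s :: nat \<Rightarrow> 'g. range s \<subseteq> carrier G \<and> (\<forall>g\<in>carrier G. \<forall>\<epsilon>>0. \<exists>i. ldist (s i) g < \<epsilon>)"
proof -
  have "\<exists>F. finite F \<and> F \<subseteq> carrier G \<and>
      (\<forall>g\<in>carrier G. len g \<le> real n \<longrightarrow> (\<exists>x\<in>F. ldist x g < 1 / real (Suc m)))" for n m
  proof -
    obtain K where K: "compactin T K" "{g \<in> carrier G. len g \<le> real n} \<subseteq> K"
      using len_proper by blast
    have KG: "K \<subseteq> carrier G" using compactin_subset_topspace[OF K(1)] by simp
    have "\<forall>g\<in>carrier G. \<exists>U. openin T U \<and> g \<in> U \<and> (\<forall>h\<in>U. ldist g h < 1 / real (Suc m))"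
      by (intro ballI ldist_neighbourhood) simp_all
    then obtain U where U: "\<And>g. g \<in> carrier G \<Longrightarrow>
        openin T (U g) \<and> g \<in> U g \<and> (\<forall>h\<in>U g. ldist g h < 1 / real (Suc m))" by metis
    have "\<forall>V\<in>U ` K. openin T V" "K \<subseteq> \<Union>(U ` K)" using U KG by auto
    then obtain \<F> where "finite \<F>" "\<F> \<subseteq> U ` K" "K \<subseteq> \<Union>\<F>"
      using K(1) unfolding compactin_def by meson
    then obtain F where F: "finite F" "F \<subseteq> K" "K \<subseteq> \<Union>(U ` F)"
      by (metis finite_subset_image)
    have "\<exists>x\<in>F. ldist x g < 1 / real (Suc m)" if g: "g \<in> carrier G" "len g \<le> real n" for g
    proof -
      have "g \<in> K" using K(2) g by blast
      then obtain x where "x \<in> F" "g \<in> U x" using F(3) by blast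
      then show ?thesis using U F(2) KG by blast
    qed
    then show ?thesis using F KG by (intro exI[of _ F]) blast
  qed
  then obtain F where F: "\<And>n m. finite (F n m)" "\<And>n m. F n m \<subseteq> carrier G"
    "\<And>n m g. \<lbrakk>g \<in> carrier G; len g \<le> real n\<rbrakk> \<Longrightarrow> \<exists>x\<in>F n m. ldist x g < 1 / real (Suc m)"
    by metis
  define D where "D = insert \<one> (\<Union>n m. F n m)"
  have "countable D" "D \<noteq> {}"
    unfolding D_def by (intro countable_insert countable_UN countable_finite F(1) countableI_type) simp
  then have D: "range (from_nat_into D) = D" by (simp add: range_from_nat_into)
  have "D \<subseteq> carrier G" using F(2) unfolding D_def by blast
  moreover have "\<exists>i. ldist (from_nat_into D i) g < \<epsilon>" if g: "g \<in> carrier G" and \<epsilon>: "\<epsilon> > 0" for g \<epsilon>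
  proof -
    obtain m where m: "1 / real (Suc m) < \<epsilon>" using \<epsilon> nat_approx_posE by blast
    obtain n where "len g \<le> real n" using real_arch_simple by blast
    then obtain x where x: "x \<in> F n m" "ldist x g < 1 / real (Suc m)" using F(3) g by blast
    then have "x \<in> D" by (auto simp: D_def)
    then obtain i where "x = from_nat_into D i" using D by (metis imageE)
    then show ?thesis using x(2) m by (intro exI[of _ i]) simp
  qed
  ultimately show ?thesis using D by (intro exI[of _ "from_nat_into D"]) simp
qed

text \<open>
  A point of the metric quotient is determined by its distances to a dense sequence, so the
  quotient embeds into \<open>nat set\<close>.
\<close>

lemma ex_code_ldist:
  "\<exists>code :: 'g \<Rightarrow> nat set. \<forall>g\<in>carrier G. \<forall>h\<in>carrier G. code g = code h \<longleftrightarrow> ldist g h = 0"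
proof -
  obtain s :: "nat \<Rightarrow> 'g" where s: "range s \<subseteq> carrier G"
      and dense: "\<And>g \<epsilon>. g \<in> carrier G \<Longrightarrow> \<epsilon> > 0 \<Longrightarrow> \<exists>i. ldist (s i) g < \<epsilon>"
    using countable_ldist_dense by blast
  have sG: "s i \<in> carrier G" for i using s by blast
  obtain c :: "(nat \<Rightarrow> real) \<Rightarrow> nat set" where c: "inj c"
    using inj_code_real_sequences by blast
  have "(\<lambda>i. ldist (s i) g) = (\<lambda>i. ldist (s i) h) \<longleftrightarrow> ldist g h = 0"
    if g: "g \<in> carrier G" and h: "h \<in> carrier G" for g h
  proof
    assume eq: "(\<lambda>i. ldist (s i) g) = (\<lambda>i. ldist (s i) h)"
    have "ldist g h \<le> 0 + \<epsilon>" if \<epsilon>: "\<epsilon> > 0" for \<epsilon>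
    proof -
      obtain i where i: "ldist (s i) g < \<epsilon> / 2" using dense[OF g half_gt_zero[OF \<epsilon>]] by blast
      then have "ldist (s i) h < \<epsilon> / 2" using fun_cong[OF eq, of i] by simp
      moreover have "ldist g h \<le> ldist g (s i) + ldist (s i) h"
        by (rule ldist_triangle[OF g sG h])
      ultimately show ?thesis using i ldist_commute[OF g sG, of i] by simp
    qed
    then have "ldist g h \<le> 0" by (rule field_le_epsilon)
    then show "ldist g h = 0" using ldist_nonneg[OF g h] by simp
  next
    assume 0: "ldist g h = 0"
    show "(\<lambda>i. ldist (s i) g) = (\<lambda>i. ldist (s i) h)"
    proof
      fix i
      show "ldist (s i) g = ldist (s i) h"
        using ldist_triangle[OF sG g h, of i] ldist_triangle[OF sG h g, of i] 0
          ldist_commute[OF g h] by simp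
    qed
  qed
  then show ?thesis
    using c by (intro exI[of _ "\<lambda>g. c (\<lambda>i. ldist (s i) g)"]) (simp add: inj_eq)
qed

end

text \<open>
  The metric quotient of \<open>G\<close>, with points named by a map \<open>code\<close> that identifies
  exactly the elements at distance \<open>0\<close>; the group acts on it by left translation.
\<close>

locale proper_length_quotient = proper_length G T len
  for G :: "'g monoid" (structure) and T len +
  fixes code :: "'g \<Rightarrow> 'x"
  assumes code_eq: "\<lbrakk>g \<in> carrier G; h \<in> carrier G\<rbrakk> \<Longrightarrow> code g = code h \<longleftrightarrow> ldist g h = 0"
begin

text \<open>The underlying set of the quotient.\<close>

definition points :: "'x set" where
  "points = code ` carrier G"

text \<open>
  A representative of a point. Outside \<open>points\<close> a dummy value keeps \<open>elt\<close> in the group, so that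
  \<open>qdist\<close>, the distance of representatives, is nonnegative and symmetric everywhere.
\<close>

definition elt :: "'x \<Rightarrow> 'g" where
  "elt x = (if x \<in> points then inv_into (carrier G) code x else \<one>)"

definition qdist :: "'x \<Rightarrow> 'x \<Rightarrow> real" where
  "qdist x y = ldist (elt x) (elt y)"

lemma elt_closed [simp]: "elt x \<in> carrier G"
  by (auto simp: points_def elt_def inv_into_into)

lemma code_elt [simp]: "x \<in> points \<Longrightarrow> code (elt x) = x"
  by (auto simp: points_def elt_def f_inv_into_f)

lemma code_points [simp]: "g \<in> carrier G \<Longrightarrow> code g \<in> points"
  by (simp add: points_def)

lemma qdist_code:
  assumes g: "g \<in> carrier G" and h: "h \<in> carrier G"
  shows "qdist (code g) (code h) = ldist g h"
proof -
  have zero: "ldist (elt (code k)) k = 0" "elt (code k) \<in> carrier G" if "k \<in> carrier G" for k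
    using that code_eq[of "elt (code k)" k] by simp_all
  let ?g = "elt (code g)" and ?h = "elt (code h)"
  note g' = zero[OF g] and h' = zero[OF h]
  have "ldist ?g ?h \<le> ldist ?g g + ldist g ?h" "ldist g ?h \<le> ldist g h + ldist h ?h"
    "ldist g h \<le> ldist g ?g + ldist ?g h" "ldist ?g h \<le> ldist ?g ?h + ldist ?h h"
    using g h g' h' by (intro ldist_triangle; simp)+
  then show ?thesis
    using g' h' ldist_commute[OF g g'(2)] ldist_commute[OF h h'(2)] by (simp add: qdist_def)
qed

sublocale Q: Metric_space points qdist
proof
  show "0 \<le> qdist x y" "qdist x y = qdist y x" for x y
    by (simp_all add: qdist_def ldist_nonneg ldist_commute)
  show "qdist x y = 0 \<longleftrightarrow> x = y" if "x \<in> points" "y \<in> points" for x y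
    using that code_eq[of "elt x" "elt y"] by (simp add: qdist_def)
  show "qdist x z \<le> qdist x y + qdist y z" if "x \<in> points" "y \<in> points" "z \<in> points" for x y z
    by (simp add: qdist_def ldist_triangle)
qed

lemma points_cases:
  assumes "x \<in> points"
  obtains g where "g \<in> carrier G" "x = code g"
  using assms by (auto simp: points_def)

lemma continuous_map_code: "continuous_map T Q.mtopology code"
  unfolding Q.continuous_map_to_metric
proof (intro ballI allI impI)
  fix g and \<epsilon> :: real assume "g \<in> topspace T" and \<epsilon>: "\<epsilon> > 0"
  then have g: "g \<in> carrier G" by simp
  obtain U where U: "openin T U" "g \<in> U" "\<forall>h\<in>U. ldist g h < \<epsilon>"
    using ldist_neighbourhood[OF g \<epsilon>] by blast
  then have "U \<subseteq> carrier G" using openin_subset by fastforce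
  then have "\<forall>h\<in>U. code h \<in> Q.mball (code g) \<epsilon>"
    using U(3) g by (auto simp: qdist_code)
  then show "\<exists>U. openin T U \<and> g \<in> U \<and> (\<forall>h\<in>U. code h \<in> Q.mball (code g) \<epsilon>)"
    using U by blast
qed

lemma proper_points: "Q.proper_metric_space"
  unfolding Q.proper_metric_space_def
proof (intro ballI allI)
  fix x r assume "x \<in> points"
  then obtain g where g: "g \<in> carrier G" "x = code g" by (rule points_cases)
  obtain K where K: "compactin T K" "{g \<in> carrier G. len g \<le> r} \<subseteq> K"
    using len_proper by blast
  have "compactin T ((\<lambda>h. g \<otimes> h) ` K)"
    using K(1) continuous_map_left_translation[OF g(1)] by (rule image_compactin)
  then have "compactin Q.mtopology (code ` (\<lambda>h. g \<otimes> h) ` K)"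
    using continuous_map_code by (rule image_compactin)
  then have "compactin Q.mtopology (code ` (\<lambda>h. g \<otimes> h) ` K \<inter> Q.mcball x r)"
    by (rule compact_Int_closedin) simp
  moreover have "Q.mcball x r \<subseteq> code ` (\<lambda>h. g \<otimes> h) ` K"
  proof
    fix y assume y: "y \<in> Q.mcball x r"
    then have "y \<in> points" by simp
    then obtain h where h: "h \<in> carrier G" "y = code h" by (rule points_cases)
    have "len (inv g \<otimes> h) \<le> r" using y g h by (simp add: qdist_code ldist_def)
    then have "inv g \<otimes> h \<in> K" using g h by (intro subsetD[OF K(2)]) simp
    moreover have "g \<otimes> (inv g \<otimes> h) = h" using g h by (simp add: m_assoc[symmetric])
    ultimately show "y \<in> code ` (\<lambda>h. g \<otimes> h) ` K" using h(2) by (metis imageI)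
  qed
  ultimately show "compactin Q.mtopology (Q.mcball x r)" by (simp add: Int_absorb1)
qed

lemma coarse_geodesic_points: "Q.coarse_geodesic_space"
proof (rule Q.coarse_geodesic_space_if_splits[OF proper_points, of "1/4" "3/2"])
  fix x y and \<epsilon> :: real
  assume "x \<in> points" "y \<in> points" and far: "3/2 < qdist x y" and \<epsilon>: "\<epsilon> > 0"
  then obtain g h where g: "g \<in> carrier G" "x = code g" and h: "h \<in> carrier G" "y = code h"
    by (metis points_cases)
  have "1 \<le> len (inv g \<otimes> h)" using far g h by (simp add: qdist_code ldist_def)
  then obtain z where z: "z \<in> carrier G" "1/4 \<le> len z" "len z \<le> 3/2"
      "len z + len (inv z \<otimes> (inv g \<otimes> h)) \<le> len (inv g \<otimes> h) + \<epsilon>"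
    using len_splits[of "inv g \<otimes> h" \<epsilon>] g h \<epsilon> by auto
  have "qdist x (code (g \<otimes> z)) = len z"
    using g z by (simp add: qdist_code ldist_def m_assoc[symmetric])
  moreover have "qdist (code (g \<otimes> z)) y = len (inv z \<otimes> (inv g \<otimes> h))"
    using g h z by (simp add: qdist_code ldist_def inv_mult_group m_assoc)
  moreover have "qdist x y = len (inv g \<otimes> h)"
    using g h by (simp add: qdist_code ldist_def)
  ultimately show "\<exists>z\<in>points. 1/4 \<le> qdist x z \<and> qdist x z \<le> 3/2 \<and>
      qdist x z + qdist z y \<le> qdist x y + \<epsilon>"
    using z g by (intro bexI[of _ "code (g \<otimes> z)"]) simp_all
qed simp_all

text \<open>The action of \<open>G\<close> by left translation, undefined outside \<open>points\<close>.\<close>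

definition translation :: "'g \<Rightarrow> 'x \<Rightarrow> 'x" where
  "translation a = (\<lambda>x\<in>points. code (a \<otimes> elt x))"

lemma translation_code:
  assumes a: "a \<in> carrier G" and g: "g \<in> carrier G"
  shows "translation a (code g) = code (a \<otimes> g)"
proof -
  have "ldist (elt (code g)) g = 0" using g code_eq[of "elt (code g)" g] by simp
  then have "ldist (a \<otimes> elt (code g)) (a \<otimes> g) = 0"
    using a g by (simp add: ldist_left_invariant)
  then show ?thesis using a g by (simp add: translation_def code_eq)
qed

lemma translation_Bij: "a \<in> carrier G \<Longrightarrow> translation a \<in> Bij points"
proof -
  assume a: "a \<in> carrier G"
  have "translation (inv b) (translation b x) = x" "translation b x \<in> points"
    if "b \<in> carrier G" "x \<in> points" for b x
    using that by (auto elim!: points_cases simp: translation_code m_assoc[symmetric])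
  then have "bij_betw (translation a) points points"
    using a by (intro bij_betw_byWitness[of _ "translation (inv a)"]) (auto, metis inv_closed inv_inv)
  then show ?thesis by (simp add: Bij_def translation_def)
qed

lemma rep_acts_on_points:
  assumes A: "group A" and rep: "discrete_cocompact_finite_kernel_rep A G T \<rho>"
  shows "Q.isometric_action A (translation \<circ> \<rho>)"
    and "Q.properly_discontinuous A (translation \<circ> \<rho>)"
    and "Q.cocompact_action A (translation \<circ> \<rho>)"
proof -
  let ?H = "\<rho> ` carrier A"
  have hom: "\<rho> \<in> hom A G" and ker: "finite (kernel A G \<rho>)"
    and disc: "discrete_subgroup ?H G T" and coc: "cocompact_subgroup ?H G T"
    using rep by (auto simp: discrete_cocompact_finite_kernel_rep_def)
  interpret \<rho>: group_hom A G \<rho>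
    using A hom by (intro group_hom.intro group_hom_axioms.intro is_group)
  have "translation \<circ> \<rho> \<in> hom A (BijGroup points)"
  proof (rule homI)
    fix a b assume a: "a \<in> carrier A" and b: "b \<in> carrier A"
    show "(translation \<circ> \<rho>) a \<in> carrier (BijGroup points)"
      using a by (simp add: BijGroup_def translation_Bij)
    show "(translation \<circ> \<rho>) (a \<otimes>\<^bsub>A\<^esub> b) =
        (translation \<circ> \<rho>) a \<otimes>\<^bsub>BijGroup points\<^esub> (translation \<circ> \<rho>) b"
    proof (rule extensionalityI[of _ points])
      fix x assume "x \<in> points"
      then obtain g where g: "g \<in> carrier G" "x = code g" by (rule points_cases)
      then show "(translation \<circ> \<rho>) (a \<otimes>\<^bsub>A\<^esub> b) x =
        ((translation \<circ> \<rho>) a \<otimes>\<^bsub>BijGroup points\<^esub> (translation \<circ> \<rho>) b) x"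
        using a b
        by (simp add: BijGroup_def translation_Bij compose_eq translation_code m_assoc)
    qed (use a b in \<open>simp_all add: BijGroup_def translation_Bij\<close>, simp add: translation_def)
  qed
  then have "group_action A points (translation \<circ> \<rho>)"
    using A group_BijGroup
    by (intro group_action.intro group_hom.intro group_hom_axioms.intro)
  moreover have "qdist (translation a x) (translation a y) = qdist x y"
    if "a \<in> carrier G" "x \<in> points" "y \<in> points" for a x y
    using that
    by (auto elim!: points_cases simp: translation_code qdist_code ldist_left_invariant)
  ultimately show "Q.isometric_action A (translation \<circ> \<rho>)"
    by (auto simp: Q.isometric_action_def)

  show "Q.properly_discontinuous A (translation \<circ> \<rho>)"
    unfolding Q.properly_discontinuous_def
  proof (intro allI impI)
    fix K L assume KL: "compactin Q.mtopology K \<and> compactin Q.mtopology L"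
    then have "Q.mbounded (insert (code \<one>) (K \<union> L))"
      using Q.compactin_imp_mbounded by (simp add: Q.mbounded_insert Q.mbounded_Un)
    then obtain r where r: "\<And>x. x \<in> K \<union> L \<Longrightarrow> qdist (code \<one>) x \<le> r"
      unfolding Q.mbounded_alt by blast
    have KLX: "K \<subseteq> points" "L \<subseteq> points"
      using KL Q.topspace_mtopology compactin_subset_topspace by metis+
    obtain C where C: "compactin T C" "{g \<in> carrier G. len g \<le> 2 * r} \<subseteq> C"
      using len_proper by blast
    have "{a \<in> carrier A. (translation \<circ> \<rho>) a ` K \<inter> L \<noteq> {}} \<subseteq> {a \<in> carrier A. \<rho> a \<in> C \<inter> ?H}"
    proof
      fix a assume "a \<in> {a \<in> carrier A. (translation \<circ> \<rho>) a ` K \<inter> L \<noteq> {}}"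
      then obtain x where a: "a \<in> carrier A" and x: "x \<in> K" "translation (\<rho> a) x \<in> L"
        by auto
      have "x \<in> points" using x KLX by blast
      then obtain g where g: "g \<in> carrier G" "x = code g" by (rule points_cases)
      have 1: "ldist \<one> g \<le> r" using r[of x] x g by (simp add: qdist_code)
      have 2: "ldist \<one> (\<rho> a \<otimes> g) \<le> r"
        using r[of "translation (\<rho> a) x"] x g a by (simp add: qdist_code translation_code)
      have "ldist (\<rho> a \<otimes> g) (\<rho> a) = ldist g \<one>"
        using ldist_left_invariant[of "\<rho> a" g \<one>] a g by simp
      then have "ldist \<one> (\<rho> a) \<le> 2 * r"
        using ldist_triangle[of \<one> "\<rho> a \<otimes> g" "\<rho> a"] 1 2 a g ldist_commute[of g \<one>] by simp
      then have "\<rho> a \<in> C" using C(2) a by (auto simp: ldist_def)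
      then show "a \<in> {a \<in> carrier A. \<rho> a \<in> C \<inter> ?H}" using a by simp
    qed
    moreover have "finite {a \<in> carrier A. \<rho> a \<in> C \<inter> ?H}"
      using ker finite_compact_Int_discrete_subgroup[OF disc C(1)]
      by (rule \<rho>.finite_preimage_of_finite_kernel)
    ultimately show "finite {a \<in> carrier A. (translation \<circ> \<rho>) a ` K \<inter> L \<noteq> {}}"
      by (rule finite_subset)
  qed

  obtain Q where Q: "compactin T Q" "carrier G \<subseteq> Q <#> ?H"
    using coc disc cocompact_subgroup_iff by (auto simp: discrete_subgroup_def)
  have QG: "Q \<subseteq> carrier G" using compactin_subset_topspace[OF Q(1)] by simp
  let ?K = "code ` (\<lambda>q. inv q) ` Q"
  have "compactin Q.mtopology ?K"
    using compactin_inverse[OF Q(1)] continuous_map_code by (rule image_compactin)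
  moreover have "(\<Union>a\<in>carrier A. (translation \<circ> \<rho>) a ` ?K) = points"
  proof
    show "(\<Union>a\<in>carrier A. (translation \<circ> \<rho>) a ` ?K) \<subseteq> points"
      using QG by (auto simp: translation_code subset_iff)
    show "points \<subseteq> (\<Union>a\<in>carrier A. (translation \<circ> \<rho>) a ` ?K)"
    proof
      fix x assume "x \<in> points"
      then obtain g where g: "g \<in> carrier G" "x = code g" by (rule points_cases)
      then have "inv g \<in> Q <#> ?H" using Q(2) by auto
      then obtain q a where q: "q \<in> Q" and a: "a \<in> carrier A" and eq: "inv g = q \<otimes> \<rho> a"
        unfolding set_mult_def by blast
      have "g = inv (q \<otimes> \<rho> a)" using eq g(1) by (metis inv_inv)
      also have "\<dots> = \<rho> (inv\<^bsub>A\<^esub> a) \<otimes> inv q"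
        using q QG a by (simp add: inv_mult_group subset_iff)
      finally have "x = (translation \<circ> \<rho>) (inv\<^bsub>A\<^esub> a) (code (inv q))"
        using q QG a g(2) by (simp add: translation_code subset_iff)
      then show "x \<in> (\<Union>a\<in>carrier A. (translation \<circ> \<rho>) a ` ?K)"
        using q a by blast
    qed
  qed
  ultimately show "Q.cocompact_action A (translation \<circ> \<rho>)"
    unfolding Q.cocompact_action_def by blast
qed

end

lemma (in proper_length) common_model_space:
  assumes "\<And>A. A \<in> \<C> \<Longrightarrow> group (A :: 'a monoid) \<and>
    (\<exists>\<rho>. discrete_cocompact_finite_kernel_rep A G T \<rho>)"
  shows "common_model_space TYPE(nat set) \<C>"
proof -
  obtain code :: "'g \<Rightarrow> nat set" where
      "\<forall>g\<in>carrier G. \<forall>h\<in>carrier G. code g = code h \<longleftrightarrow> ldist g h = 0"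
    using ex_code_ldist by blast
  then interpret proper_length_quotient G T len code by unfold_locales blast
  have "points \<noteq> {}" using code_points[OF one_closed] by blast
  moreover have "\<exists>\<phi>. Q.isometric_action A \<phi> \<and> Q.properly_discontinuous A \<phi> \<and> Q.cocompact_action A \<phi>"
    if "A \<in> \<C>" for A
    using assms[OF that] rep_acts_on_points by blast
  ultimately show ?thesis
    unfolding common_model_space_def
    using Q.Metric_space_axioms proper_points coarse_geodesic_points by blast
qed

section \<open>A proper length function on a compactly generated group\<close>

lemma (in lc_group) ex_bump_function:
  "\<exists>(f :: 'g \<Rightarrow> real) C. continuous_map T euclideanreal f \<and> (\<forall>x\<in>carrier G. 0 \<le> f x \<and> f x \<le> 1) \<and>
     f \<one> = 1 \<and> compactin T C \<and> {x \<in> carrier G. f x \<noteq> 0} \<subseteq> C"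
proof -
  obtain U C where UC: "openin T U" "compactin T C" "\<one> \<in> U" "U \<subseteq> C"
    using locally_compact unfolding locally_compact_space_def by (metis one_closed topspace_eq)
  have "completely_regular_space T"
    using locally_compact Hausdorff by (intro locally_compact_regular_imp_completely_regular_space) auto
  moreover have "closedin T (topspace T - U)" "\<one> \<in> topspace T - (topspace T - U)"
    using UC closedin_diff[OF closedin_topspace UC(1)] by simp_all
  ultimately obtain h :: "'g \<Rightarrow> real" where h: "continuous_map T (top_of_set {0..1}) h"
      "h \<one> = 0" "h ` (topspace T - U) \<subseteq> {1}"
    unfolding completely_regular_space_def by metis
  have "continuous_map T euclideanreal (\<lambda>x. 1 - h x)"
    using h(1) by (intro continuous_map_diff) (auto simp: continuous_map_in_subtopology)
  moreover have "0 \<le> h x \<and> h x \<le> 1" if "x \<in> carrier G" for x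
    using h(1) that by (fastforce simp: continuous_map_in_subtopology)
  moreover have "{x \<in> carrier G. 1 - h x \<noteq> 0} \<subseteq> C"
    using h(3) UC(4) by auto
  ultimately show ?thesis
    using h(2) UC(2) by (intro exI[of _ "\<lambda>x. 1 - h x"] exI[of _ C]) auto
qed

text \<open>
  A group generated by a compact symmetric set \<open>W\<close>, with a bump function at the identity that is
  supported in \<open>W\<close>.
\<close>

locale compactly_generated_bump = lc_group G T for G :: "'g monoid" (structure) and T +
  fixes f :: "'g \<Rightarrow> real" and W :: "'g set"
  assumes f_continuous: "continuous_map T euclideanreal f"
    and f_range: "x \<in> carrier G \<Longrightarrow> 0 \<le> f x \<and> f x \<le> 1"
    and f_one: "f \<one> = 1"
    and f_support: "\<lbrakk>x \<in> carrier G; f x \<noteq> 0\<rbrakk> \<Longrightarrow> x \<in> W"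
    and W_compact: "compactin T W"
    and W_inv: "s \<in> W \<Longrightarrow> inv s \<in> W"
    and W_generates: "generate G W = carrier G"
begin

lemma W_closed: "W \<subseteq> carrier G"
  using compactin_subset_topspace[OF W_compact] by simp

text \<open>How far left translation by \<open>s\<close> moves \<open>f\<close> in the uniform norm.\<close>

definition osc :: "'g \<Rightarrow> real" where
  "osc s = (SUP x\<in>carrier G. \<bar>f x - f (inv s \<otimes> x)\<bar>)"

lemma osc_diff_le_1:
  assumes "s \<in> carrier G" "x \<in> carrier G"
  shows "\<bar>f x - f (inv s \<otimes> x)\<bar> \<le> 1"
  using f_range[of x] f_range[of "inv s \<otimes> x"] assms by (simp add: abs_le_iff)

lemma osc_upper:
  assumes "s \<in> carrier G" "x \<in> carrier G"
  shows "\<bar>f x - f (inv s \<otimes> x)\<bar> \<le> osc s"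
  unfolding osc_def
  by (rule cSUP_upper[OF assms(2)])
    (use osc_diff_le_1[OF assms(1)] in \<open>auto intro!: bdd_aboveI[of _ 1]\<close>)

lemma osc_least: "(\<And>x. x \<in> carrier G \<Longrightarrow> \<bar>f x - f (inv s \<otimes> x)\<bar> \<le> b) \<Longrightarrow> osc s \<le> b"
  unfolding osc_def by (rule cSUP_least) auto

lemma osc_nonneg: "s \<in> carrier G \<Longrightarrow> 0 \<le> osc s"
  using osc_upper[of s \<one>] by simp

lemma osc_le_1: "s \<in> carrier G \<Longrightarrow> osc s \<le> 1"
  by (rule osc_least) (rule osc_diff_le_1)

lemma osc_one: "osc \<one> = 0"
  using osc_least[of \<one> 0] osc_nonneg[of \<one>] by simp

lemma osc_mult:
  assumes s: "s \<in> carrier G" and t: "t \<in> carrier G"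
  shows "osc (s \<otimes> t) \<le> osc s + osc t"
proof (rule osc_least)
  fix x assume x: "x \<in> carrier G"
  have "inv (s \<otimes> t) \<otimes> x = inv t \<otimes> (inv s \<otimes> x)"
    using s t x by (simp add: inv_mult_group m_assoc)
  then show "\<bar>f x - f (inv (s \<otimes> t) \<otimes> x)\<bar> \<le> osc s + osc t"
    using osc_upper[OF s x] osc_upper[OF t, of "inv s \<otimes> x"] s x by simp
qed

lemma osc_inv_le:
  assumes s: "s \<in> carrier G"
  shows "osc (inv s) \<le> osc s"
proof (rule osc_least)
  fix x assume x: "x \<in> carrier G"
  have "inv s \<otimes> (s \<otimes> x) = x" using s x by (simp add: m_assoc[symmetric])
  then show "\<bar>f x - f (inv (inv s) \<otimes> x)\<bar> \<le> osc s"
    using osc_upper[OF s, of "s \<otimes> x"] s x by simp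
qed

lemma osc_inv: "s \<in> carrier G \<Longrightarrow> osc (inv s) = osc s"
  using osc_inv_le[of s] osc_inv_le[of "inv s"] by simp

lemma osc_less_1_imp_W:
  assumes s: "s \<in> carrier G" and "osc s < 1"
  shows "s \<in> W"
proof -
  have "\<bar>f s - f \<one>\<bar> < 1" using osc_upper[OF s s] assms by simp
  then show ?thesis using f_one f_support[OF s] by auto
qed

text \<open>Uniform continuity of the compactly supported function \<open>f\<close>, by the tube lemma.\<close>

lemma osc_small_near_one:
  assumes \<epsilon>: "\<epsilon> > 0"
  shows "\<exists>N. openin T N \<and> \<one> \<in> N \<and> N \<subseteq> W \<and> (\<forall>s\<in>N. osc s < \<epsilon>)"
proof -
  let ?O = "{z \<in> topspace (prod_topology T T). \<bar>f (snd z) - f (inv (fst z) \<otimes> snd z)\<bar> \<in> {..<\<epsilon>/2}}"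
  have "continuous_map (prod_topology T T) euclideanreal (\<lambda>z. \<bar>f (snd z) - f (inv (fst z) \<otimes> snd z)\<bar>)"
    by (intro continuous_map_real_abs continuous_map_diff
        continuous_map_compose[OF _ f_continuous, unfolded o_def]
        continuous_map_mult continuous_map_inverse continuous_map_fst continuous_map_snd)
  then have O: "openin (prod_topology T T) ?O"
    by (rule openin_continuous_map_preimage) simp
  have "{\<one>} \<times> W \<subseteq> ?O" using W_closed \<epsilon> by auto
  then obtain N V where N: "openin T N" "\<one> \<in> N" "W \<subseteq> V" "N \<times> V \<subseteq> ?O"
    using tube_lemma_right[OF O W_compact, of \<one>] by auto
  have NG: "N \<subseteq> carrier G" using openin_subset[OF N(1)] by simp
  have near: "\<bar>f x - f (inv s \<otimes> x)\<bar> < \<epsilon>/2" if "s \<in> N" "x \<in> W" for s x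
  proof -
    have "(s, x) \<in> ?O" using that N by blast
    then show ?thesis by simp
  qed
  define N' where "N' = N \<inter> {s \<in> topspace T. inv s \<in> N} \<inter> {s \<in> topspace T. f s \<in> {0<..}}"
  have "continuous_map T T (\<lambda>x. inv x)" by (intro continuous_map_inverse) simp
  then have "openin T N'"
    unfolding N'_def
    by (intro openin_Int N(1) openin_continuous_map_preimage[OF _ N(1)]
        openin_continuous_map_preimage[OF f_continuous]) auto
  moreover have "\<one> \<in> N'" using N(2) f_one by (simp add: N'_def)
  moreover have "N' \<subseteq> W" using f_support by (auto simp: N'_def)
  moreover have "osc s < \<epsilon>" if s: "s \<in> N'" for s
  proof -
    have sN: "s \<in> N" "inv s \<in> N" "s \<in> carrier G" using s NG by (auto simp: N'_def)
    have "osc s \<le> \<epsilon>/2"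
    proof (rule osc_least)
      fix x assume x: "x \<in> carrier G"
      \<comment> \<open>If \<open>f\<close> takes different values at \<open>x\<close> and \<open>inv s \<otimes> x\<close>, one of these points lies in \<open>W\<close>.\<close>
      consider "x \<in> W" | "inv s \<otimes> x \<in> W" | "f x = 0" "f (inv s \<otimes> x) = 0"
        using f_support[of x] f_support[of "inv s \<otimes> x"] x sN(3) by auto
      then show "\<bar>f x - f (inv s \<otimes> x)\<bar> \<le> \<epsilon>/2"
      proof cases
        case 1
        then show ?thesis using near[OF sN(1)] by (simp add: less_imp_le)
      next
        case 2
        have "s \<otimes> (inv s \<otimes> x) = x" using sN(3) x by (simp add: m_assoc[symmetric])
        then show ?thesis using near[OF sN(2) 2] sN(3) by (simp add: abs_minus_commute)
      next
        case 3
        then show ?thesis using \<epsilon> by simp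
      qed
    qed
    then show ?thesis using \<epsilon> by simp
  qed
  ultimately show ?thesis by blast
qed

text \<open>\<open>reach g r\<close>: the element \<open>g\<close> is a product of elements of \<open>W\<close> of total cost \<open>r\<close>.\<close>

inductive reach :: "'g \<Rightarrow> real \<Rightarrow> bool" where
  reach_one: "reach \<one> 0"
| reach_step: "s \<in> W \<Longrightarrow> reach g r \<Longrightarrow> reach (s \<otimes> g) (osc s + r)"

lemma reach_closed: "reach g r \<Longrightarrow> g \<in> carrier G"
  by (induction rule: reach.induct) (use W_closed in auto)

lemma reach_nonneg: "reach g r \<Longrightarrow> 0 \<le> r"
  by (induction rule: reach.induct) (use W_closed osc_nonneg in \<open>auto intro!: add_nonneg_nonneg\<close>)

lemma reach_mult:
  assumes "reach g r" "reach h q"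
  shows "reach (g \<otimes> h) (r + q)"
  using assms(1)
proof (induction rule: reach.induct)
  case reach_one
  then show ?case using assms(2) reach_closed by simp
next
  case (reach_step s g r)
  have "s \<otimes> g \<otimes> h = s \<otimes> (g \<otimes> h)"
    using W_closed reach_step.hyps reach_closed assms(2) by (intro m_assoc) auto
  then show ?case
    using reach.reach_step[OF reach_step.hyps(1) reach_step.IH] by (simp add: add.assoc)
qed

lemma reach_generator: "s \<in> W \<Longrightarrow> reach s (osc s)"
  using reach_step[OF _ reach_one, of s] W_closed by auto

lemma reach_inv: "reach g r \<Longrightarrow> reach (inv g) r"
proof (induction rule: reach.induct)
  case reach_one
  then show ?case using reach.reach_one by simp
next
  case (reach_step s g r)
  have "reach (inv g \<otimes> inv s) (r + osc (inv s))"
    using reach_step by (intro reach_mult reach_generator W_inv)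
  then show ?case
    using reach_step W_closed reach_closed by (simp add: inv_mult_group osc_inv subset_iff add.commute)
qed

lemma reach_exists:
  assumes "g \<in> carrier G"
  shows "\<exists>r. reach g r"
proof -
  have "g \<in> generate G W" using assms W_generates by simp
  then show ?thesis
    by (induction rule: generate.induct)
      (blast intro: reach_one reach_generator W_inv reach_mult)+
qed

text \<open>
  Some prefix of a factorisation has cost between \<open>a\<close> and \<open>a + 1\<close>, because single steps cost at
  most \<open>1\<close>.
\<close>

lemma reach_prefix:
  assumes "reach g r" "0 \<le> a" "a \<le> r"
  shows "\<exists>z u p q. g = z \<otimes> u \<and> reach z p \<and> reach u q \<and> p + q = r \<and> a \<le> p \<and> p \<le> a + 1"
  using assms
proof (induction arbitrary: a rule: reach.induct)
  case reach_one
  then show ?case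
    by (intro exI[of _ \<one>] exI[of _ 0]) (auto intro: reach.reach_one)
next
  case (reach_step s g r)
  have s: "s \<in> carrier G" using reach_step W_closed by blast
  show ?case
  proof (cases "a \<le> osc s")
    case True
    then show ?thesis
      using reach_step.hyps reach_step.prems reach_generator osc_le_1[OF s]
      by (intro exI[of _ s] exI[of _ g] exI[of _ "osc s"] exI[of _ r]) auto
  next
    case False
    then obtain z u p q where z: "g = z \<otimes> u" "reach z p" "reach u q" "p + q = r"
        "a - osc s \<le> p" "p \<le> a - osc s + 1"
      using reach_step.IH[of "a - osc s"] reach_step.prems by auto
    have "s \<otimes> g = (s \<otimes> z) \<otimes> u"
      using z s reach_closed by (simp add: m_assoc)
    then show ?thesis
      using z reach.reach_step[OF reach_step.hyps(1) z(2)]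
      by (intro exI[of _ "s \<otimes> z"] exI[of _ u] exI[of _ "osc s + p"] exI[of _ q]) auto
  qed
qed

text \<open>Products of exactly \<open>n\<close> elements of \<open>W\<close>.\<close>

primrec W_power :: "nat \<Rightarrow> 'g set" where
  "W_power 0 = {\<one>}"
| "W_power (Suc n) = W <#> W_power n"

lemma compactin_W_power: "compactin T (W_power n)"
  by (induction n) (auto intro: compactin_set_mult W_compact)

text \<open>
  Consecutive steps of total cost less than \<open>1\<close> merge into a single step, so a factorisation of
  cost \<open>r\<close> can be shortened to at most \<open>2 r + 1\<close> steps.
\<close>

lemma reach_imp_bounded_word:
  assumes "reach g r"
  shows "\<exists>k t w. g = t \<otimes> w \<and> t \<in> carrier G \<and> osc t < 1 \<and> w \<in> W_power (2 * k) \<and> real k + osc t \<le> r"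
  using assms
proof (induction rule: reach.induct)
  case reach_one
  then show ?case by (intro exI[of _ 0] exI[of _ \<one>]) (simp add: osc_one)
next
  case (reach_step s g r)
  then obtain k t w where t: "g = t \<otimes> w" "t \<in> carrier G" "osc t < 1"
      and w: "w \<in> W_power (2 * k)" and le: "real k + osc t \<le> r" by blast
  have s: "s \<in> carrier G" using reach_step W_closed by blast
  have wG: "w \<in> carrier G" using w compactin_subset_topspace[OF compactin_W_power] by auto
  show ?case
  proof (cases "osc s + osc t < 1")
    case True
    then show ?thesis
      using t w wG le s osc_mult[OF s t(2)]
      by (intro exI[of _ k] exI[of _ "s \<otimes> t"] exI[of _ w]) (simp add: m_assoc)
  next
    case False
    have "s \<otimes> (t \<otimes> w) \<in> W_power (2 * Suc k)"
      using reach_step.hyps(1) osc_less_1_imp_W[OF t(2,3)] w by (auto simp: set_mult_def)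
    then show ?thesis
      using False t w wG le s
      by (intro exI[of _ "Suc k"] exI[of _ \<one>] exI[of _ "s \<otimes> g"]) (simp add: osc_one)
  qed
qed

text \<open>The infimum of the costs of factorisations over \<open>W\<close>.\<close>

definition len :: "'g \<Rightarrow> real" where
  "len g = Inf {r. reach g r}"

lemma len_le: "reach g r \<Longrightarrow> len g \<le> r"
  unfolding len_def by (rule cInf_lower) (auto intro!: bdd_belowI[of _ 0] reach_nonneg)

lemma len_approx:
  assumes "g \<in> carrier G" "\<epsilon> > 0"
  shows "\<exists>r. reach g r \<and> r < len g + \<epsilon>"
proof -
  have "{r. reach g r} \<noteq> {}" "Inf {r. reach g r} < len g + \<epsilon>"
    using reach_exists[OF assms(1)] assms(2) by (auto simp: len_def)
  then show ?thesis using cInf_lessD[of "{r. reach g r}"] by auto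
qed

lemma len_ge_0: "g \<in> carrier G \<Longrightarrow> 0 \<le> len g"
  unfolding len_def using reach_exists by (intro cInf_greatest) (auto intro: reach_nonneg)

lemma len_mult_le:
  assumes g: "g \<in> carrier G" and h: "h \<in> carrier G"
  shows "len (g \<otimes> h) \<le> len g + len h"
proof (rule field_le_epsilon)
  fix \<epsilon> :: real assume "\<epsilon> > 0"
  then obtain r q where "reach g r" "r < len g + \<epsilon>/2" "reach h q" "q < len h + \<epsilon>/2"
    using len_approx[OF g, of "\<epsilon>/2"] len_approx[OF h, of "\<epsilon>/2"] by auto
  then show "len (g \<otimes> h) \<le> len g + len h + \<epsilon>"
    using len_le[OF reach_mult[of g r h q]] by simp
qed

lemma proper_length_len: "proper_length G T len"
proof unfold_locales
  fix g h assume g: "g \<in> carrier G" and h: "h \<in> carrier G"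
  show "len (g \<otimes> h) \<le> len g + len h" using g h by (rule len_mult_le)
next
  fix g assume g: "g \<in> carrier G"
  show "0 \<le> len g" using g by (rule len_ge_0)
  have "{r. reach (inv g) r} = {r. reach g r}"
    using reach_inv[of g] reach_inv[of "inv g"] g by auto
  then show "len (inv g) = len g" by (simp add: len_def)
next
  show "len \<one> = 0" using len_le[OF reach_one] len_ge_0[of \<one>] by simp
next
  fix \<epsilon> :: real assume \<epsilon>: "\<epsilon> > 0"
  obtain N where N: "openin T N" "\<one> \<in> N" "N \<subseteq> W" "\<forall>s\<in>N. osc s < \<epsilon>"
    using osc_small_near_one[OF \<epsilon>] by blast
  moreover have "len s < \<epsilon>" if "s \<in> N" for s
    using len_le[OF reach_generator, of s] N that by force
  ultimately show "\<exists>N. openin T N \<and> \<one> \<in> N \<and> (\<forall>g\<in>N. len g < \<epsilon>)" by blast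
next
  fix R :: real
  let ?n = "nat \<lfloor>R + 1\<rfloor>"
  have "compactin T (\<Union>k\<le>?n. W_power (Suc (2 * k)))"
    by (intro compactin_Union) (auto intro: compactin_W_power simp del: W_power.simps)
  moreover have "{g \<in> carrier G. len g \<le> R} \<subseteq> (\<Union>k\<le>?n. W_power (Suc (2 * k)))"
  proof clarify
    fix g assume g: "g \<in> carrier G" "len g \<le> R"
    obtain r where r: "reach g r" "r < len g + 1" using len_approx[OF g(1), of 1] by auto
    obtain k t w where t: "g = t \<otimes> w" "t \<in> carrier G" "osc t < 1"
      and w: "w \<in> W_power (2 * k)" and le: "real k + osc t \<le> r"
      using reach_imp_bounded_word[OF r(1)] by blast
    have "real k \<le> R + 1" using le osc_nonneg[OF t(2)] r(2) g(2) by simp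
    then have "k \<le> ?n" by (rule le_nat_floor)
    moreover have "g \<in> W_power (Suc (2 * k))"
      using t w osc_less_1_imp_W[OF t(2,3)] by (auto simp: set_mult_def)
    ultimately show "g \<in> (\<Union>k\<le>?n. W_power (Suc (2 * k)))" by blast
  qed
  ultimately show "\<exists>K. compactin T K \<and> {g \<in> carrier G. len g \<le> R} \<subseteq> K" by blast
next
  fix g and \<epsilon> :: real assume g: "g \<in> carrier G" "1 \<le> len g" and \<epsilon>: "\<epsilon> > 0"
  \<comment> \<open>A prefix of cost \<open>p\<close> in \<open>[1/2, 3/2]\<close> of a factorisation that is optimal up to \<open>1/4\<close> has length
    at least \<open>p - 1/4\<close>.\<close>
  obtain r where r: "reach g r" "r < len g + min \<epsilon> (1/4)"
    using len_approx[OF g(1), of "min \<epsilon> (1/4)"] \<epsilon> by auto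
  then have "1/2 \<le> r" using len_le[OF r(1)] g(2) by simp
  then obtain z u p q where z: "g = z \<otimes> u" "reach z p" "reach u q" "p + q = r" "1/2 \<le> p" "p \<le> 1/2 + 1"
    using reach_prefix[OF r(1), of "1/2"] by auto
  have zu: "z \<in> carrier G" "u \<in> carrier G" using z reach_closed by auto
  have u: "inv z \<otimes> g = u" using z(1) zu by (simp add: m_assoc[symmetric])
  have "len g \<le> len z + len u" using len_mult_le[OF zu] z(1) by simp
  moreover have "len z \<le> p" "len u \<le> q" using z len_le by auto
  ultimately have "1/4 \<le> len z" "len z \<le> 3/2" "len z + len u \<le> len g + \<epsilon>"
    using z r by auto
  then show "\<exists>z\<in>carrier G. 1/4 \<le> len z \<and> len z \<le> 3/2 \<and> len z + len (inv z \<otimes> g) \<le> len g + \<epsilon>"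
    using zu u by auto
qed

end

section \<open>The equivalence\<close>

text \<open>
  With no group in the collection, nothing makes the locally compact group compactly generated;
  a single point serves as the model space.
\<close>

lemma common_model_space_empty: "common_model_space TYPE(nat set) {}"
proof -
  define \<delta> :: "nat set \<Rightarrow> nat set \<Rightarrow> real" where "\<delta> = (\<lambda>_ _. 0)"
  interpret Metric_space "{{}} :: nat set set" \<delta> by unfold_locales (auto simp: \<delta>_def)
  have "proper_metric_space"
    unfolding proper_metric_space_def
  proof (intro ballI allI finite_imp_compactin)
    fix x :: "nat set" and r :: real
    show "mcball x r \<subseteq> topspace mtopology"
      unfolding topspace_mtopology by (rule mcball_subset_mspace)
    show "finite (mcball x r)"
      by (rule finite_subset[OF mcball_subset_mspace]) simp
  qed
  moreover have "coarse_geodesic_space"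
  proof -
    have "coarse_geodesic 0 {} {} 0 (\<lambda>_. {})"
      by (simp add: coarse_geodesic_def coarse_path_def path_len_def)
    then have "\<exists>n p. coarse_geodesic 0 {} {} n p" by blast
    then show ?thesis unfolding coarse_geodesic_space_def by (intro exI[of _ 0]) simp
  qed
  ultimately show ?thesis
    unfolding common_model_space_def using Metric_space_axioms by blast
qed

lemma common_locally_compact_group_imp_common_model_space:
  assumes fg: "\<forall>A\<in>\<C>. finitely_generated_group (A :: 'a monoid)"
    and lc: "common_locally_compact_group TYPE('g) \<C>"
  shows "common_model_space TYPE(nat set) \<C>"
proof (cases "\<C> = {}")
  case True
  then show ?thesis using common_model_space_empty by simp
next
  case False
  obtain G :: "'g monoid" and T where G: "locally_compact_group G T"
    and rep: "\<And>A. A \<in> \<C> \<Longrightarrow> \<exists>\<rho>. discrete_cocompact_finite_kernel_rep A G T \<rho>"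
    using lc unfolding common_locally_compact_group_def by blast
  interpret lc_group G T using G by unfold_locales
  obtain A where A: "A \<in> \<C>" using False by blast
  obtain S where S: "group A" "finite S" "S \<subseteq> carrier A" "generate A S = carrier A"
    using fg A unfolding finitely_generated_group_def by blast
  obtain \<rho> where \<rho>: "discrete_cocompact_finite_kernel_rep A G T \<rho>" using rep[OF A] by blast
  have hom: "\<rho> \<in> hom A G" and coc: "cocompact_subgroup (\<rho> ` carrier A) G T"
    using \<rho> by (auto simp: discrete_cocompact_finite_kernel_rep_def)
  interpret \<rho>: group_hom A G \<rho>
    using S(1) hom by (intro group_hom.intro group_hom_axioms.intro is_group)
  obtain Q where Q: "compactin T Q" "carrier G \<subseteq> Q <#>\<^bsub>G\<^esub> \<rho> ` carrier A"
    using coc cocompact_subgroup_iff[OF \<rho>.img_is_subgroup] by blast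
  obtain f :: "'g \<Rightarrow> real" and C where f: "continuous_map T euclideanreal f"
      "\<forall>x\<in>carrier G. 0 \<le> f x \<and> f x \<le> 1" "f \<one>\<^bsub>G\<^esub> = 1"
      and C: "compactin T C" "{x \<in> carrier G. f x \<noteq> 0} \<subseteq> C"
    using ex_bump_function by blast
  \<comment> \<open>The group is generated by \<open>Q\<close> and the images of the generators of \<open>A\<close>.\<close>
  define W0 where "W0 = Q \<union> \<rho> ` S \<union> C"
  define W where "W = W0 \<union> (\<lambda>x. inv\<^bsub>G\<^esub> x) ` W0"
  have "compactin T (\<rho> ` S)"
    using S(2,3) by (intro finite_imp_compactin) auto
  then have "compactin T W0" unfolding W0_def by (intro compactin_Un Q(1) C(1))
  then have W: "compactin T W"
    unfolding W_def by (intro compactin_Un compactin_inverse)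
  then have WG: "W \<subseteq> carrier G" using compactin_subset_topspace by fastforce
  have "generate G W = carrier G"
  proof
    show "generate G W \<subseteq> carrier G" using WG by (rule generate_incl)
    have "\<rho> ` carrier A = generate G (\<rho> ` S)"
      using \<rho>.generate_img[OF S(3)] S(4) by simp
    also have "\<dots> \<subseteq> generate G W" by (rule mono_generate) (auto simp: W_def W0_def)
    finally have H: "\<rho> ` carrier A \<subseteq> generate G W" .
    have "Q \<subseteq> generate G W" by (auto simp: W_def W0_def intro: generate.incl)
    then have "Q <#>\<^bsub>G\<^esub> \<rho> ` carrier A \<subseteq> generate G W"
      using H unfolding set_mult_def by (blast intro: generate.eng)
    then show "carrier G \<subseteq> generate G W" using Q(2) by blast
  qed
  moreover have "inv\<^bsub>G\<^esub> s \<in> W" if "s \<in> W" for s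
  proof -
    have "W0 \<subseteq> carrier G" using WG by (simp add: W_def)
    then show ?thesis using that by (auto simp: W_def)
  qed
  moreover have "{x \<in> carrier G. f x \<noteq> 0} \<subseteq> W" using C(2) by (auto simp: W_def W0_def)
  ultimately interpret compactly_generated_bump G T f W
    using f W by unfold_locales auto
  interpret proper_length G T len by (rule proper_length_len)
  show ?thesis
    using fg rep by (intro common_model_space) (auto simp: finitely_generated_group_def)
qed

theorem corollary7:
  fixes \<C> :: "'a monoid set"
  assumes "\<forall>G\<in>\<C>. finitely_generated_group G"
  shows "(common_model_space TYPE('x) \<C> \<longrightarrow> common_locally_compact_group TYPE(nat set) \<C>) \<and>
         (common_locally_compact_group TYPE('g) \<C> \<longrightarrow> common_model_space TYPE(nat set) \<C>)"
proof (intro conjI impI)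
  assume "common_model_space TYPE('x) \<C>"
  moreover have "\<forall>G\<in>\<C>. group G" using assms by (simp add: finitely_generated_group_def)
  ultimately show "common_locally_compact_group TYPE(nat set) \<C>"
    by (intro common_model_space_imp_common_locally_compact_group)
next
  assume "common_locally_compact_group TYPE('g) \<C>"
  with assms show "common_model_space TYPE(nat set) \<C>"
    by (rule common_locally_compact_group_imp_common_model_space)
qed

end
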